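(* For every $x>0$, let $$Y_x:=\left(\max_{0\le s\le 1}W(s)-\min_{0\le t\le 1}W(t)-2x\right)_+ .$$ Then the taut string energy constant $\mathcal{C}$ (defined in the context) satisfies $$\mathcal{C}^2\ \ge\ x^2\,\mathbb{E}\,Y_x^2\ >\ 0 .$$
   Context: $W=(W(t))_{0\le t\le 1}$ is a standard one-dimensional Wiener process with $W(0)=0$; $(a)_+:=\max(a,0)$. $\|h\|_1:=\sup_{0\le t\le 1}|h(t)|$; $AC[0,1]$ is the set of absolutely continuous real functions on $[0,1]$, and $|h|_1:=\left(\int_0^1 h'(t)^2\,dt\right)^{1/2}$ (possibly $+\infty$). For $\varepsilon>0$, $$I_W(1,\varepsilon):=\inf\{|h|_1:\ h\in AC[0,1],\ \|h-W\|_1\le\varepsilon,\ h(0)=0\}.$$ The constant $\mathcal{C}\in[0,\infty)$ is the (unique) deterministic number such that, for every $q>0$, $\mathbb{E}\left|\varepsilon I_W(1,\varepsilon)-\mathcal{C}\right|^q\to 0$ as $\varepsilon\to 0$; the existence of such a constant is another theorem of the paper. *)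

theory Defs
  imports "HOL-Probability.Probability"
begin

section \<open>Standard Wiener process on the unit interval\<close>

text \<open>All sample paths (not just almost all of them) are continuous and start at \<open>0\<close>.\<close>

locale standard_wiener_process = prob_space M
  for M :: "'a measure" +
  fixes W :: "real \<Rightarrow> 'a \<Rightarrow> real"
  assumes random_variable_W: "\<And>t. t \<in> {0..1} \<Longrightarrow> random_variable borel (W t)"
    and W_0: "\<And>\<omega>. \<omega> \<in> space M \<Longrightarrow> W 0 \<omega> = 0"
    and continuous_paths: "\<And>\<omega>. \<omega> \<in> space M \<Longrightarrow> continuous_on {0..1} (\<lambda>t. W t \<omega>)"
    and normal_increments:
      "\<And>s t. 0 \<le> s \<Longrightarrow> s < t \<Longrightarrow> t \<le> 1 \<Longrightarrow>
        distributed M lborel (\<lambda>\<omega>. W t \<omega> - W s \<omega>) (normal_density 0 (sqrt (t - s)))"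
    and independent_increments:
      "\<And>(n::nat) \<tau>. mono_on {..n} \<tau> \<Longrightarrow> \<tau> ` {..n} \<subseteq> {0..1} \<Longrightarrow>
        indep_vars (\<lambda>_. borel) (\<lambda>i \<omega>. W (\<tau> (Suc i)) \<omega> - W (\<tau> i) \<omega>) {..<n}"


section \<open>Taut string energy\<close>

text \<open>Functions on \<open>[0,1]\<close> are total functions \<open>real \<Rightarrow> real\<close>;
  none of the notions below depends on the values outside \<open>[0,1]\<close>.\<close>

definition sup_norm :: "(real \<Rightarrow> real) \<Rightarrow> real" where
  "sup_norm h = (SUP t\<in>{0..1}. \<bar>h t\<bar>)"

definition AC :: "(real \<Rightarrow> real) set" where
  "AC = {h. \<forall>e>0. \<exists>d>0. \<forall>(n::nat) a b.
      (\<forall>i<n. 0 \<le> a i \<and> a i < b i \<and> b i \<le> 1) \<longrightarrow>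
      disjoint_family_on (\<lambda>i. {a i<..<b i}) {..<n} \<longrightarrow>
      (\<Sum>i<n. b i - a i) < d \<longrightarrow>
      (\<Sum>i<n. \<bar>h (b i) - h (a i)\<bar>) < e}"

text \<open>Only used for \<open>h \<in> AC\<close>: such \<open>h\<close> is differentiable almost everywhere on \<open>[0,1]\<close>, so the
  arbitrary value of \<^term>\<open>deriv h t\<close> at the remaining points is irrelevant.\<close>

definition energy :: "(real \<Rightarrow> real) \<Rightarrow> ennreal" where
  "energy h = (\<integral>\<^sup>+t\<in>{0..1}. ennreal ((deriv h t)\<^sup>2) \<partial>lborel)"

definition energy_norm :: "(real \<Rightarrow> real) \<Rightarrow> ennreal" where
  "energy_norm h = (if energy h = \<infinity> then \<infinity> else ennreal (sqrt (enn2real (energy h))))"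

definition taut_string :: "(real \<Rightarrow> real) \<Rightarrow> real \<Rightarrow> ennreal" where
  "taut_string w \<epsilon> =
    (INF h\<in>{h \<in> AC. sup_norm (\<lambda>t. h t - w t) \<le> \<epsilon> \<and> h 0 = 0}. energy_norm h)"

text \<open>\<open>\<bar>a - c\<bar>\<^sup>q\<close> for extended \<open>a\<close>, with value \<open>\<infinity>\<close> at \<open>a = \<infinity>\<close>.\<close>

definition deviation_powr :: "real \<Rightarrow> ennreal \<Rightarrow> real \<Rightarrow> ennreal" where
  "deviation_powr q a c = (if a = \<infinity> then \<infinity> else ennreal (\<bar>enn2real a - c\<bar> powr q))"

definition is_taut_string_constant :: "'a measure \<Rightarrow> (real \<Rightarrow> 'a \<Rightarrow> real) \<Rightarrow> real \<Rightarrow> bool" where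
  "is_taut_string_constant M W C \<longleftrightarrow> 0 \<le> C \<and>
    (\<forall>q>0. ((\<lambda>\<epsilon>. \<integral>\<^sup>+\<omega>. deviation_powr q (ennreal \<epsilon> * taut_string (\<lambda>t. W t \<omega>) \<epsilon>) C \<partial>M)
      \<longlongrightarrow> 0) (at_right 0))"


section \<open>Truncated range\<close>

text \<open>For a continuous path the supremum and infimum are the maximum and minimum.\<close>

definition truncated_range :: "(real \<Rightarrow> real) \<Rightarrow> real \<Rightarrow> real" where
  "truncated_range w x = max ((SUP s\<in>{0..1}. w s) - (INF t\<in>{0..1}. w t) - 2 * x) 0"

end

theory Submission
  imports Defs "HOL-Real_Asymp.Real_Asymp"
begin

text \<open>The energy of a competitor in the tube of radius \<open>\<epsilon>\<close> around the path can be bounded below locally.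
On an interval of length \<open>1/n\<close>, every function \<open>h\<close> in the tube has to travel at least the range of
\<open>W\<close> on that interval minus \<open>2\<epsilon>\<close>, and by the Cauchy-Schwarz inequality travelling a distance \<open>r\<close>
costs energy at least \<open>n r\<^sup>2\<close>. Choose \<open>\<epsilon> = x / sqrt n\<close>. By Brownian scaling, \<open>sqrt n\<close> times the
truncated excess of the range on the \<open>i\<close>th block is a copy \<open>Y\<^sub>i\<close> of \<open>Y\<^sub>x\<close>, and so the energy of
every competitor, multiplied by \<open>\<epsilon>\<^sup>2\<close>, is at least \<open>(x\<^sup>2/n) \<Sum> Y\<^sub>i\<^sup>2\<close>. The latter has mean
\<open>x\<^sup>2 E Y\<^sub>x\<^sup>2\<close> for every \<open>n\<close>, whereas \<open>\<epsilon>\<close> times the taut string value, the square root of the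
infimal energy, converges to \<open>C\<close> in \<open>L\<^sup>2\<close>; this gives \<open>x\<^sup>2 E Y\<^sub>x\<^sup>2 \<le> C\<^sup>2\<close>. The expectation is positive since the range is at least \<open>W(1) - W(0)\<close>,
which exceeds \<open>2x\<close> with positive probability. Finiteness of \<open>E Y\<^sub>x\<^sup>2\<close> comes out of the bound itself.

Three points need care. First, the energy integrates the square of the pointwise derivative, so the
local estimate rests on the fundamental theorem of calculus for absolutely continuous functions
(\<open>AC_fundamental_theorem\<close>), including their differentiability almost everywhere. The latter holds for
functions of bounded variation (\<open>negligible_not_differentiable\<close>): where difference quotients
oscillate, a partition with nearly maximal variation could be refined to one of larger variation.
Secondly, the distributional identity of the blocks is read off from finitely many increments; hence
ranges are first taken over grids, where everything is a function of independent normal variables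
(\<open>nn_integral_block_range\<close>), and Fatou's lemma refines the grid (\<open>truncated_range_moment_le\<close>).
Thirdly, the integral of the deviation of the taut string value is a supremum over measurable
minorants, as the measurability of that value in the path is not established. Thus the argument
(\<open>grid_moment_le\<close>) only ever integrates the explicit lower bound and its excess over \<open>C\<close>.\<close>

section \<open>Nonoverlapping families of intervals\<close>

text \<open>A pair \<open>(u, v)\<close> stands for the interval \<open>[u, v]\<close>. Intervals of a family may share endpoints, so
the pieces of a partition qualify.\<close>

definition segs :: "real \<Rightarrow> real \<Rightarrow> (real \<times> real) set \<Rightarrow> bool" where
  "segs a b P \<longleftrightarrow> finite P \<and> (\<forall>(u,v)\<in>P. a \<le> u \<and> u < v \<and> v \<le> b) \<and>
     pairwise (\<lambda>p q. snd p \<le> fst q \<or> snd q \<le> fst p) P"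

definition incr :: "(real \<Rightarrow> real) \<Rightarrow> real \<times> real \<Rightarrow> real" where
  "incr g p = g (snd p) - g (fst p)"

abbreviation len :: "(real \<times> real) set \<Rightarrow> real" where
  "len P \<equiv> \<Sum>p\<in>P. snd p - fst p"

abbreviation var :: "(real \<Rightarrow> real) \<Rightarrow> (real \<times> real) set \<Rightarrow> real" where
  "var g P \<equiv> \<Sum>p\<in>P. \<bar>incr g p\<bar>"

lemma segs_finite: "segs a b P \<Longrightarrow> finite P"
  by (simp add: segs_def)

lemma segs_bounds: "segs a b P \<Longrightarrow> p \<in> P \<Longrightarrow> a \<le> fst p \<and> fst p < snd p \<and> snd p \<le> b"
  by (auto simp: segs_def)

lemma segs_sep: "segs a b P \<Longrightarrow> p \<in> P \<Longrightarrow> q \<in> P \<Longrightarrow> p \<noteq> q \<Longrightarrow> snd p \<le> fst q \<or> snd q \<le> fst p"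
  by (auto simp: segs_def pairwise_def)

lemma segsI:
  assumes "finite P" "\<And>p. p \<in> P \<Longrightarrow> a \<le> fst p \<and> fst p < snd p \<and> snd p \<le> b"
    "\<And>p q. p \<in> P \<Longrightarrow> q \<in> P \<Longrightarrow> p \<noteq> q \<Longrightarrow> snd p \<le> fst q \<or> snd q \<le> fst p"
  shows "segs a b P"
  unfolding segs_def pairwise_def
proof (intro conjI ballI impI)
  show "case p of (u, v) \<Rightarrow> a \<le> u \<and> u < v \<and> v \<le> b" if "p \<in> P" for p
    using assms(2)[OF that] by (simp add: split_beta)
qed (use assms in blast)+

text \<open>Completion of a family to a partition by the family \<open>Q\<close> of its gaps. The identity for arbitrary
\<open>g\<close> is what converts knowledge of the sign of the increments over \<open>F\<close> into a gain of variation.\<close>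

lemma segs_gaps:
  assumes "segs u v F" "u \<le> v"
  obtains Q where "segs u v (F \<union> Q)" "F \<inter> Q = {}"
    "\<And>g. sum (incr g) F + sum (incr g) Q = g v - g u"
    "{u<..<v} \<subseteq> (\<Union>p\<in>F \<union> Q. {fst p..snd p})"
proof -
  have "\<exists>Q. segs u v (F \<union> Q) \<and> F \<inter> Q = {} \<and>
    (\<forall>g. sum (incr g) F + sum (incr g) Q = g v - g u) \<and>
    {u<..<v} \<subseteq> (\<Union>p\<in>F \<union> Q. {fst p..snd p})"
    using assms
  proof (induction "card F" arbitrary: F v)
    case 0
    then have F: "F = {}" using segs_finite by auto
    show ?case
    proof (cases "u = v")
      case True
      then show ?thesis using F by (intro exI[of _ "{}"]) (auto simp: segs_def)
    next
      case False
      then show ?thesis using F 0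
        by (intro exI[of _ "{(u,v)}"]) (auto simp: segs_def incr_def)
    qed
  next
    case (Suc k)
    have fin: "finite F" using Suc.prems segs_finite by auto
    have ne: "F \<noteq> {}" using Suc.hyps by auto
    obtain m where m: "m \<in> F" "\<And>p. p \<in> F \<Longrightarrow> fst p \<le> fst m"
      by (rule obtains_MAX[OF fin ne, of fst]) (metis Max_ge fin finite_imageI image_eqI)
    let ?F = "F - {m}"
    have mb: "u \<le> fst m" "fst m < snd m" "snd m \<le> v" using segs_bounds[OF Suc.prems(1) m(1)] by auto
    have left: "snd p \<le> fst m" if "p \<in> ?F" for p
      using segs_sep[OF Suc.prems(1), of p m] segs_bounds[OF Suc.prems(1), of p] m(1) m(2)[of p] mb that by auto
    have "segs u (fst m) ?F"
      using left segs_bounds[OF Suc.prems(1)] segs_sep[OF Suc.prems(1)] fin by (intro segsI) auto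
    moreover have "k = card ?F" using Suc.hyps(2) m(1) fin by simp
    ultimately obtain Q where Q: "segs u (fst m) (?F \<union> Q)" "?F \<inter> Q = {}"
      "\<And>g. sum (incr g) ?F + sum (incr g) Q = g (fst m) - g u"
      "{u<..<fst m} \<subseteq> (\<Union>p\<in>?F \<union> Q. {fst p..snd p})"
      using Suc.hyps(1)[of ?F "fst m"] mb(1) by blast
    define R where "R = (if snd m < v then {(snd m, v)} else {})"
    have FQ: "F \<union> (Q \<union> R) = (?F \<union> Q) \<union> ({m} \<union> R)" using m by auto
    have bR: "fst m \<le> fst p \<and> fst p < snd p \<and> snd p \<le> v" if "p \<in> {m} \<union> R" for p
      using that mb by (auto simp: R_def split: if_splits)
    have bQ: "u \<le> fst p \<and> fst p < snd p \<and> snd p \<le> fst m" if "p \<in> ?F \<union> Q" for p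
      using segs_bounds[OF Q(1) that] by auto
    have sR: "snd p \<le> fst q \<or> snd q \<le> fst p" if "p \<in> {m} \<union> R" "q \<in> {m} \<union> R" "p \<noteq> q" for p q
      using that by (auto simp: R_def split: if_splits)
    have 1: "segs u v (F \<union> (Q \<union> R))"
      unfolding FQ
    proof (rule segsI)
      show "finite (?F \<union> Q \<union> ({m} \<union> R))" using segs_finite[OF Q(1)] by (auto simp: R_def)
      show "u \<le> fst p \<and> fst p < snd p \<and> snd p \<le> v" if "p \<in> ?F \<union> Q \<union> ({m} \<union> R)" for p
      proof (cases "p \<in> ?F \<union> Q")
        case True
        then show ?thesis using bQ[OF True] mb by linarith
      next
        case False
        then show ?thesis using that bR[of p] mb by auto
      qed
      show "snd p \<le> fst q \<or> snd q \<le> fst p"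
        if "p \<in> ?F \<union> Q \<union> ({m} \<union> R)" "q \<in> ?F \<union> Q \<union> ({m} \<union> R)" "p \<noteq> q" for p q
      proof (cases "p \<in> ?F \<union> Q"; cases "q \<in> ?F \<union> Q")
        assume "p \<in> ?F \<union> Q" "q \<in> ?F \<union> Q"
        then show ?thesis using segs_sep[OF Q(1), of p q] that by auto
      next
        assume "p \<in> ?F \<union> Q" "q \<notin> ?F \<union> Q"
        then show ?thesis using bQ[of p] bR[of q] bQ[of q] bR[of p] that by force
      next
        assume "p \<notin> ?F \<union> Q" "q \<in> ?F \<union> Q"
        then show ?thesis using bQ[of p] bR[of q] bQ[of q] bR[of p] that by force
      next
        assume "p \<notin> ?F \<union> Q" "q \<notin> ?F \<union> Q"
        then show ?thesis using sR[of p q] that by auto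
      qed
    qed
    have mQ: "m \<notin> Q" using bQ[of m] mb by auto
    have Rd: "p \<notin> F \<union> Q" if "p \<in> R" for p
    proof -
      have "p = (snd m, v)" "snd m < v" using that by (auto simp: R_def split: if_splits)
      then show ?thesis using bQ[of p] mb m(2)[of p] by auto
    qed
    have 2: "F \<inter> (Q \<union> R) = {}" using Q(2) mQ Rd by auto
    have 3: "sum (incr g) F + sum (incr g) (Q \<union> R) = g v - g u" for g
    proof -
      have "sum (incr g) F = incr g m + sum (incr g) ?F" using fin m(1) by (simp add: sum.remove)
      moreover have "sum (incr g) (Q \<union> R) = sum (incr g) Q + sum (incr g) R"
        using Rd segs_finite[OF Q(1)] by (intro sum.union_disjoint) (auto simp: R_def)
      moreover have "sum (incr g) R = g v - g (snd m)" using mb by (auto simp: R_def incr_def)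
      ultimately show ?thesis using Q(3)[of g] by (simp add: incr_def)
    qed
    have 4: "{u<..<v} \<subseteq> (\<Union>p\<in>F \<union> (Q \<union> R). {fst p..snd p})"
    proof
      fix x assume x: "x \<in> {u<..<v}"
      consider "x < fst m" | "fst m \<le> x" "x \<le> snd m" | "snd m < x" by linarith
      then show "x \<in> (\<Union>p\<in>F \<union> (Q \<union> R). {fst p..snd p})"
      proof cases
        case 1
        then have "x \<in> {u<..<fst m}" using x by auto
        then show ?thesis using Q(4) by blast
      next
        case 2
        then show ?thesis using m(1) by auto
      next
        case 3
        then have "(snd m, v) \<in> R" using x by (auto simp: R_def)
        then show ?thesis using 3 x by (intro UN_I[of "(snd m, v)"]) auto
      qed
    qed
    show ?case using 1 2 3 4 by blast
  qed
  then show ?thesis using that by blast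
qed

lemma segs_len_le_measure:
  assumes P: "segs a b P" and sub: "\<And>p. p \<in> P \<Longrightarrow> {fst p<..<snd p} \<subseteq> U" and U: "U \<in> lmeasurable"
  shows "len P \<le> measure lebesgue U"
proof -
  have "len P = (\<Sum>p\<in>P. measure lebesgue {fst p<..<snd p})"
    using segs_bounds[OF P] by (intro sum.cong) force+
  also have "\<dots> = measure lebesgue (\<Union>p\<in>P. {fst p<..<snd p})"
  proof (rule measure_finite_Union[symmetric])
    show "disjoint_family_on (\<lambda>p. {fst p<..<snd p}) P"
      using segs_sep[OF P] by (force simp: disjoint_family_on_def)
    show "emeasure lebesgue {fst p<..<snd p} \<noteq> \<infinity>" if "p \<in> P" for p
      using segs_bounds[OF P that] by simp
  qed (use segs_finite[OF P] in auto)
  also have "\<dots> \<le> measure lebesgue U"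
    using sub U by (intro measure_mono_fmeasurable) (auto intro!: sets.finite_UN segs_finite[OF P])
  finally show ?thesis .
qed

text \<open>Vitali's covering theorem as an estimate of outer measure: a set covered in the Vitali sense by
intervals from \<open>K\<close> is small if the finite nonoverlapping families from \<open>K\<close> have small total length.
The sets to which this applies are given only through such coverings, so \<open>S\<close> is arbitrary.\<close>

lemma vitali_len:
  fixes S :: "real set"
  assumes cov: "\<And>x d. x \<in> S \<Longrightarrow> 0 < d \<Longrightarrow> \<exists>p\<in>K. x \<in> {fst p..snd p} \<and> snd p - fst p < d"
    and K: "\<And>p. p \<in> K \<Longrightarrow> a \<le> fst p \<and> fst p < snd p \<and> snd p \<le> b"
    and B: "\<And>F. F \<subseteq> K \<Longrightarrow> segs a b F \<Longrightarrow> len F \<le> B"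
  obtains T where "S \<subseteq> T" "T \<in> lmeasurable" "measure lebesgue T \<le> B"
proof -
  let ?c = "\<lambda>p::real\<times>real. (fst p + snd p) / 2" and ?r = "\<lambda>p::real\<times>real. (snd p - fst p) / 2"
  have cb: "cball (?c p) (?r p) = {fst p..snd p}" for p
    unfolding cball_eq_atLeastAtMost by (rule arg_cong2[where f=atLeastAtMost]) (auto simp: field_simps)
  obtain C where C: "countable C" "C \<subseteq> K"
     "pairwise (\<lambda>i j. disjnt (cball (?c i) (?r i)) (cball (?c j) (?r j))) C"
     "negligible (S - (\<Union>i \<in> C. cball (?c i) (?r i)))"
  proof (rule Vitali_covering_theorem_cballs[of K ?r S ?c])
    show "0 < ?r i" if "i \<in> K" for i using K[OF that] by simp
    show "\<exists>i. i \<in> K \<and> x \<in> cball (?c i) (?r i) \<and> ?r i < d" if xd: "x \<in> S" "0 < d" for x d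
    proof -
      obtain p where "p \<in> K" "x \<in> {fst p..snd p}" "snd p - fst p < d" using cov[OF xd] by blast
      then show ?thesis using K[of p] by (intro exI[of _ p]) (auto simp: cb)
    qed
  qed
  let ?U = "\<Union>p\<in>C. {fst p..snd p}"
  have fin: "measure lebesgue (\<Union>p\<in>F. {fst p..snd p}) \<le> B" if F: "F \<subseteq> C" "finite F" for F
  proof -
    have sg: "segs a b F"
    proof (rule segsI)
      show "snd p \<le> fst q \<or> snd q \<le> fst p" if "p \<in> F" "q \<in> F" "p \<noteq> q" for p q
      proof (rule ccontr)
        assume "\<not> ?thesis"
        moreover have pK: "fst p < snd p" "fst q < snd q" using K[of p] K[of q] that F C(2) by auto
        ultimately have "max (fst p) (fst q) \<in> {fst p..snd p} \<inter> {fst q..snd q}"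
          using pK by auto
        moreover have "disjnt {fst p..snd p} {fst q..snd q}"
          using C(3) that F(1) unfolding cb pairwise_def by blast
        ultimately show False by (auto simp: disjnt_def)
      qed
    qed (use F C(2) K in auto)
    have "measure lebesgue (\<Union>p\<in>F. {fst p..snd p}) \<le> (\<Sum>p\<in>F. measure lebesgue {fst p..snd p})"
      using F by (intro measure_UNION_le) auto
    also have "\<dots> = len F" using segs_bounds[OF sg] by (intro sum.cong) force+
    also have "\<dots> \<le> B" using B[OF _ sg] F C(2) by auto
    finally show ?thesis .
  qed
  have U: "?U \<in> lmeasurable" and mU: "measure lebesgue ?U \<le> B"
    by (rule fmeasurable_UN_bound[OF C(1) _ fin] measure_UN_bound[OF C(1) _ fin]; simp)+
  let ?N = "S - ?U"
  have N: "negligible ?N" using C(4) unfolding cb .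
  show ?thesis
  proof (rule that[of "?U \<union> ?N"])
    show "S \<subseteq> ?U \<union> ?N" by blast
    show "?U \<union> ?N \<in> lmeasurable" using U negligible_imp_measurable[OF N] by (rule fmeasurable.Un)
    show "measure lebesgue (?U \<union> ?N) \<le> B"
      using measure_Un_le[OF fmeasurableD[OF U] fmeasurableD[OF negligible_imp_measurable[OF N]]]
        mU negligible_imp_measure0[OF N] by linarith
  qed
qed

section \<open>Differentiability of functions of bounded variation\<close>

lemma
  assumes P: "segs a b P" and R: "\<And>p. p \<in> P \<Longrightarrow> segs (fst p) (snd p) (R p)"
  shows segs_UN: "segs a b (\<Union>p\<in>P. R p)"
    and sum_segs_UN: "sum f (\<Union>p\<in>P. R p) = (\<Sum>p\<in>P. sum f (R p))"
proof -
  have bd: "fst p \<le> fst q" "fst q < snd q" "snd q \<le> snd p" if "p \<in> P" "q \<in> R p" for p q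
    using segs_bounds[OF R[OF that(1)] that(2)] by auto
  show "segs a b (\<Union>p\<in>P. R p)"
  proof (rule segsI)
    show "finite (\<Union>p\<in>P. R p)" using segs_finite[OF P] segs_finite[OF R] by simp
    show "a \<le> fst q \<and> fst q < snd q \<and> snd q \<le> b" if "q \<in> (\<Union>p\<in>P. R p)" for q
    proof -
      obtain p where p: "p \<in> P" "q \<in> R p" using \<open>q \<in> _\<close> by blast
      show ?thesis using bd[OF p] segs_bounds[OF P p(1)] by linarith
    qed
    show "snd q \<le> fst q' \<or> snd q' \<le> fst q"
      if qq: "q \<in> (\<Union>p\<in>P. R p)" "q' \<in> (\<Union>p\<in>P. R p)" "q \<noteq> q'" for q q'
    proof -
      obtain p where p: "p \<in> P" "q \<in> R p" using qq by blast
      obtain p' where p': "p' \<in> P" "q' \<in> R p'" using qq by blast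
      show ?thesis
      proof (cases "p = p'")
        case True
        then show ?thesis using segs_sep[OF R[OF p(1)] p(2) _ qq(3)] p' by blast
      next
        case False
        then show ?thesis using segs_sep[OF P p(1) p'(1)] bd[OF p] bd[OF p'] by linarith
      qed
    qed
  qed
  show "sum f (\<Union>p\<in>P. R p) = (\<Sum>p\<in>P. sum f (R p))"
  proof (rule sum.UNION_disjoint)
    show "\<forall>p\<in>P. \<forall>p'\<in>P. p \<noteq> p' \<longrightarrow> R p \<inter> R p' = {}"
    proof (intro ballI impI equals0I)
      fix p p' q assume p: "p \<in> P" "p' \<in> P" "p \<noteq> p'" "q \<in> R p \<inter> R p'"
      then have "q \<in> R p" "q \<in> R p'" by auto
      then show False
        using segs_sep[OF P p(1,2,3)] bd[OF p(1), of q] bd[OF p(2), of q] by linarith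
    qed
  qed (use segs_finite[OF P] segs_finite[OF R] in auto)
qed

text \<open>The intervals satisfying \<open>A\<close> cover \<open>x\<close> in the sense of Vitali. With \<open>A\<close> a condition on the slope of
a function, this expresses bounds for Dini derivatives; since \<open>x\<close> may lie anywhere in the interval,
one-sided derivatives are covered too.\<close>

definition steep_near :: "((real \<times> real) \<Rightarrow> bool) \<Rightarrow> real \<Rightarrow> bool" where
  "steep_near A x \<longleftrightarrow>
     (\<forall>d>0. \<exists>p. fst p < snd p \<and> x \<in> {fst p..snd p} \<and> snd p - fst p < d \<and> A p)"

text \<open>The argument goes back to Austin and Botsko. Take a partition \<open>P\<close> whose variation is within
\<open>2 \<alpha> e\<close> of the supremum \<open>V\<close>. Inside a piece over which \<open>g\<close> increases, cover the exceptional points by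
intervals of slope below \<open>-\<alpha>\<close>, and inside a piece over which \<open>g\<close> decreases, by intervals of slope
above \<open>\<alpha>\<close>. Moving against the trend has to be compensated in the gaps, so cutting \<open>P\<close> at a family
of such intervals of total length \<open>l\<close> raises the variation by at least \<open>2 \<alpha> l\<close>. Hence \<open>l \<le> e\<close>.\<close>

lemma negligible_crossing:
  assumes bv: "\<And>P. segs a b P \<Longrightarrow> var g P \<le> B" and "\<alpha> > 0" and "a < b"
  shows "negligible {x\<in>{a<..<b}. steep_near (\<lambda>p. incr g p < - \<alpha> * (snd p - fst p)) x \<and>
           steep_near (\<lambda>p. \<alpha> * (snd p - fst p) < incr g p) x}" (is "negligible ?E")
  unfolding negligible_outer_le
proof (intro allI impI)
  fix e :: real assume "e > 0"
  define V where "V = Sup (var g ` {P. segs a b P})"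
  have bdd: "bdd_above (var g ` {P. segs a b P})" using bv by (auto intro!: bdd_aboveI[of _ B])
  have V: "var g P \<le> V" if "segs a b P" for P
    unfolding V_def using that by (intro cSUP_upper bdd) auto
  have ne: "var g ` {P. segs a b P} \<noteq> {}"
    using segsI[of "{}" a b] by auto
  have "V - 2 * \<alpha> * e < V" using \<open>\<alpha> > 0\<close> \<open>e > 0\<close> by simp
  then obtain P0 where P0: "segs a b P0" "V - 2 * \<alpha> * e < var g P0"
    unfolding V_def using less_cSup_iff[OF ne bdd] by auto
  obtain Q0 where Q0: "segs a b (P0 \<union> Q0)" "P0 \<inter> Q0 = {}"
     "{a<..<b} \<subseteq> (\<Union>p\<in>P0 \<union> Q0. {fst p..snd p})"
    using segs_gaps[OF P0(1)] \<open>a < b\<close> by (metis less_imp_le)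
  define P where "P = P0 \<union> Q0"
  have P: "segs a b P" using Q0 by (simp add: P_def)
  have "var g P0 \<le> var g P"
    unfolding P_def using segs_finite[OF Q0(1)] by (intro sum_mono2) auto
  with P0 have PV: "V - 2 * \<alpha> * e < var g P" by simp
  \<comment> \<open>At an endpoint of a piece, small covering intervals need not lie within a single piece.\<close>
  define N where "N = fst ` P \<union> snd ` P"
  have N: "finite N" using segs_finite[OF P] by (simp add: N_def)
  define S where "S = ?E \<inter> (\<Union>p\<in>P. {fst p<..<snd p})"
  have ESN: "?E \<subseteq> S \<union> N"
  proof
    fix x assume x: "x \<in> ?E"
    then obtain p where "p \<in> P" "x \<in> {fst p..snd p}" using Q0(3) unfolding P_def by blast
    then show "x \<in> S \<union> N" using x unfolding S_def N_def
      by (cases "x = fst p"; cases "x = snd p") (force simp: image_iff)+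
  qed
  \<comment> \<open>The trend of \<open>g\<close> over a piece \<open>p\<close>; the covering intervals run against it.\<close>
  define sg where "sg p = (if incr g p \<ge> 0 then 1 else - 1 :: real)" for p
  define K where "K = {q. fst q < snd q \<and> (\<exists>p\<in>P. fst p \<le> fst q \<and> snd q \<le> snd p \<and>
      sg p * incr g q < - \<alpha> * (snd q - fst q))}"
  obtain T where T: "S \<subseteq> T" "T \<in> lmeasurable" "measure lebesgue T \<le> e"
  proof (rule vitali_len[of S K a b e])
    fix x d :: real assume xd: "x \<in> S" "0 < d"
    then obtain p where p: "p \<in> P" "fst p < x" "x < snd p" by (auto simp: S_def)
    let ?d = "min d (min (x - fst p) (snd p - x))"
    have d: "?d > 0" using p xd by auto
    have "steep_near (\<lambda>q. sg p * incr g q < - \<alpha> * (snd q - fst q)) x"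
      using xd(1) by (auto simp: S_def sg_def)
    then obtain q where q: "fst q < snd q" "x \<in> {fst q..snd q}" "snd q - fst q < ?d"
      "sg p * incr g q < - \<alpha> * (snd q - fst q)"
      using d unfolding steep_near_def by blast
    moreover have "q \<in> K" unfolding K_def using p q by (auto intro!: bexI[of _ p])
    ultimately show "\<exists>p\<in>K. x \<in> {fst p..snd p} \<and> snd p - fst p < d" by auto
  next
    fix q assume "q \<in> K"
    then obtain p where "p \<in> P" "fst p \<le> fst q" "snd q \<le> snd p" "fst q < snd q" by (auto simp: K_def)
    then show "a \<le> fst q \<and> fst q < snd q \<and> snd q \<le> b" using segs_bounds[OF P, of p] by auto
  next
    fix F assume F: "F \<subseteq> K" "segs a b F"
    define G where "G p = {q \<in> F. fst p \<le> fst q \<and> snd q \<le> snd p}" for p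
    have GS: "segs (fst p) (snd p) (G p)" for p
      using segs_bounds[OF F(2)] segs_sep[OF F(2)] segs_finite[OF F(2)]
      by (intro segsI) (auto simp: G_def)
    have Gsteep: "sg p * incr g q \<le> - \<alpha> * (snd q - fst q)" if p: "p \<in> P" and q: "q \<in> G p" for p q
    proof -
      have "q \<in> K" using q F by (auto simp: G_def)
      then obtain p' where p': "p' \<in> P" "fst p' \<le> fst q" "snd q \<le> snd p'" "fst q < snd q"
        "sg p' * incr g q < - \<alpha> * (snd q - fst q)" by (auto simp: K_def)
      have "p = p'" using segs_sep[OF P p p'(1)] p' q by (force simp: G_def)
      then show ?thesis using p' by simp
    qed
    \<comment> \<open>Cutting the piece \<open>p\<close> at \<open>G p\<close>: the intervals of \<open>G p\<close> contribute their increments in modulus, and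
        the gaps \<open>Q\<close> have to make up for them as well as for the increment over \<open>p\<close>.\<close>
    have "\<exists>R. segs (fst p) (snd p) R \<and> \<bar>incr g p\<bar> + 2 * \<alpha> * len (G p) \<le> var g R" if p: "p \<in> P" for p
    proof -
      have "fst p \<le> snd p" using segs_bounds[OF P p] by simp
      then obtain Q where Q: "segs (fst p) (snd p) (G p \<union> Q)" "G p \<inter> Q = {}"
        "sum (incr g) (G p) + sum (incr g) Q = g (snd p) - g (fst p)"
        using segs_gaps[OF GS[of p]] by metis
      have fin: "finite (G p)" "finite Q" using segs_finite[OF Q(1)] by auto
      have "\<alpha> * len (G p) \<le> - sg p * sum (incr g) (G p)"
        unfolding sum_distrib_left sum_negf[symmetric]
        by (rule sum_mono) (use Gsteep[OF p] in force)
      moreover have "- sg p * sum (incr g) (G p) \<le> var g (G p)"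
      proof -
        have "- sg p * sum (incr g) (G p) \<le> \<bar>sum (incr g) (G p)\<bar>" by (auto simp: sg_def)
        also have "\<dots> \<le> var g (G p)" by (rule sum_abs)
        finally show ?thesis .
      qed
      moreover have "\<bar>incr g p\<bar> - sg p * sum (incr g) (G p) \<le> var g Q"
      proof -
        have "sum (incr g) Q = incr g p - sum (incr g) (G p)" using Q(3) by (simp add: incr_def)
        then have "\<bar>incr g p\<bar> - sg p * sum (incr g) (G p) \<le> \<bar>sum (incr g) Q\<bar>" by (auto simp: sg_def)
        also have "\<dots> \<le> var g Q" by (rule sum_abs)
        finally show ?thesis .
      qed
      moreover have "var g (G p \<union> Q) = var g (G p) + var g Q"
        by (rule sum.union_disjoint[OF fin Q(2)])
      ultimately have "\<bar>incr g p\<bar> + 2 * \<alpha> * len (G p) \<le> var g (G p \<union> Q)" by simp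
      then show ?thesis using Q(1) by blast
    qed
    then obtain R where R: "\<And>p. p \<in> P \<Longrightarrow> segs (fst p) (snd p) (R p)"
      "\<And>p. p \<in> P \<Longrightarrow> \<bar>incr g p\<bar> + 2 * \<alpha> * len (G p) \<le> var g (R p)"
      by metis
    have "F = (\<Union>p\<in>P. G p)" using F(1) by (auto simp: G_def K_def)
    then have "len F = (\<Sum>p\<in>P. len (G p))" using sum_segs_UN[OF P GS] by simp
    then have "var g P + 2 * \<alpha> * len F = (\<Sum>p\<in>P. \<bar>incr g p\<bar> + 2 * \<alpha> * len (G p))"
      by (simp add: sum.distrib sum_distrib_left)
    also have "\<dots> \<le> (\<Sum>p\<in>P. var g (R p))" by (intro sum_mono R)
    also have "\<dots> = var g (\<Union>p\<in>P. R p)" by (rule sum_segs_UN[OF P R(1), symmetric])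
    also have "\<dots> \<le> V" by (intro V segs_UN[OF P R(1)])
    finally have "2 * \<alpha> * len F < 2 * \<alpha> * e" using PV by simp
    then show "len F \<le> e" using \<open>\<alpha> > 0\<close> by simp
  qed
  have N': "N \<in> lmeasurable" "measure lebesgue N = 0"
    using negligible_finite[OF N] negligible_imp_measurable negligible_imp_measure0 by blast+
  show "\<exists>T. ?E \<subseteq> T \<and> T \<in> lmeasurable \<and> measure lebesgue T \<le> e"
  proof (intro exI conjI)
    show "?E \<subseteq> T \<union> N" using ESN T(1) by blast
    show "T \<union> N \<in> lmeasurable" using T(2) N'(1) by (rule fmeasurable.Un)
    show "measure lebesgue (T \<union> N) \<le> e"
      using measure_Un_le[OF fmeasurableD[OF T(2)] fmeasurableD[OF N'(1)]] T(3) N'(2) by linarith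
  qed
qed

text \<open>Nonoverlapping intervals on which the slope exceeds \<open>k\<close> in modulus have total length at most \<open>B / k\<close>.\<close>

lemma negligible_unbounded_slopes:
  assumes bv: "\<And>P. segs a b P \<Longrightarrow> var g P \<le> B"
  shows "negligible {x\<in>{a<..<b}. \<forall>k. steep_near (\<lambda>p. k * (snd p - fst p) < \<bar>incr g p\<bar>) x}"
    (is "negligible ?E")
  unfolding negligible_outer_le
proof (intro allI impI)
  fix e :: real assume "e > 0"
  have "B \<ge> 0" using bv[of "{}"] segsI[of "{}" a b] by simp
  \<comment> \<open>\<open>B + 1\<close> rather than \<open>B\<close> makes \<open>k\<close> positive.\<close>
  define k where "k = (B + 1) / e"
  have k: "k > 0" "k * e \<ge> B" using \<open>B \<ge> 0\<close> \<open>e > 0\<close> by (auto simp: k_def)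
  define K where "K = {q. a \<le> fst q \<and> fst q < snd q \<and> snd q \<le> b \<and> k * (snd q - fst q) < \<bar>incr g q\<bar>}"
  show "\<exists>T. ?E \<subseteq> T \<and> T \<in> lmeasurable \<and> measure lebesgue T \<le> e"
  proof (rule vitali_len[of ?E K a b e])
    fix x d :: real assume xd: "x \<in> ?E" "0 < d"
    let ?d = "min d (min (x - a) (b - x))"
    have d: "?d > 0" using xd by auto
    have "steep_near (\<lambda>p. k * (snd p - fst p) < \<bar>incr g p\<bar>) x" using xd by auto
    then obtain q where q: "fst q < snd q" "x \<in> {fst q..snd q}" "snd q - fst q < ?d"
      "k * (snd q - fst q) < \<bar>incr g q\<bar>"
      using d unfolding steep_near_def by blast
    then have "q \<in> K" by (auto simp: K_def)
    then show "\<exists>p\<in>K. x \<in> {fst p..snd p} \<and> snd p - fst p < d" using q by auto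
  next
    fix F assume F: "F \<subseteq> K" "segs a b F"
    have "k * len F \<le> var g F"
      unfolding sum_distrib_left using F(1) by (intro sum_mono) (auto simp: K_def less_imp_le)
    also have "\<dots> \<le> k * e" using bv[OF F(2)] k(2) by simp
    finally show "len F \<le> e" using k(1) by simp
  qed (auto simp: K_def)
qed

text \<open>Rational thresholds \<open>r\<close> and \<open>s\<close> make the set of points of oscillation a countable union.\<close>

lemma converges_or_oscillates:
  fixes q :: "'b \<Rightarrow> real"
  assumes F: "F \<noteq> bot"
  obtains D where "(q \<longlongrightarrow> D) F"
  | "\<And>k. \<exists>\<^sub>F y in F. k < \<bar>q y\<bar>"
  | r s where "r \<in> \<rat>" "s \<in> \<rat>" "r < s" "\<exists>\<^sub>F y in F. q y < r" "\<exists>\<^sub>F y in F. s < q y"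
proof -
  let ?q = "\<lambda>y. ereal (q y)"
  consider (bdd) k where "\<forall>\<^sub>F y in F. \<bar>q y\<bar> \<le> k" | (unb) "\<And>k. \<exists>\<^sub>F y in F. k < \<bar>q y\<bar>"
    unfolding frequently_def not_less by blast
  then show ?thesis
  proof cases
    case bdd
    have le: "Liminf F ?q \<le> Limsup F ?q" by (rule Liminf_le_Limsup[OF F])
    have up: "Limsup F ?q \<le> ereal k" by (rule Limsup_bounded) (use bdd in \<open>auto elim: eventually_mono\<close>)
    have lo: "ereal (- k) \<le> Liminf F ?q"
      by (rule Liminf_bounded) (use bdd in \<open>auto elim: eventually_mono\<close>)
    show ?thesis
    proof (cases "Liminf F ?q = Limsup F ?q")
      case True
      obtain D where D: "Limsup F ?q = ereal D"
        using up lo le by (cases "Limsup F ?q") (auto simp: True)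
      have "(?q \<longlongrightarrow> ereal D) F"
        using True D by (intro Liminf_eq_Limsup[OF F]) auto
      then show ?thesis using that(1) by simp
    next
      case False
      then have "Liminf F ?q < Limsup F ?q" using le by simp
      then obtain u where u: "Liminf F ?q < u" "u < Limsup F ?q" using dense by blast
      obtain r' where r': "Liminf F ?q < ereal r'" "ereal r' < u" using ereal_dense2[OF u(1)] by blast
      obtain s' where s': "u < ereal s'" "ereal s' < Limsup F ?q" using ereal_dense2[OF u(2)] by blast
      have "r' < s'" using r' s' by (meson ereal_less_eq(3) less_trans not_le less_ereal.simps(1))
      then obtain r where r: "r \<in> \<rat>" "r' < r" "r < s'" using Rats_dense_in_real by blast
      obtain s where s: "s \<in> \<rat>" "r < s" "s < s'" using Rats_dense_in_real[OF r(3)] by blast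
      have "\<exists>\<^sub>F y in F. q y < r"
      proof (rule ccontr)
        assume "\<not> ?thesis"
        then have "\<forall>\<^sub>F y in F. ereal r \<le> ?q y" by (simp add: frequently_def not_less)
        then have "ereal r \<le> Liminf F ?q" by (rule Liminf_bounded)
        then show False using r' r by (meson ereal_less_eq(3) leD less_le_trans less_imp_le)
      qed
      moreover have "\<exists>\<^sub>F y in F. s < q y"
      proof (rule ccontr)
        assume "\<not> ?thesis"
        then have "\<forall>\<^sub>F y in F. ?q y \<le> ereal s" by (simp add: frequently_def not_less)
        then have "Limsup F ?q \<le> ereal s" by (rule Limsup_bounded)
        then show False using s' s by (meson ereal_less_eq(3) leD le_less_trans less_imp_le)
      qed
      ultimately show ?thesis using that(3) r s by blast
    qed
  next
    case unb
    then show ?thesis using that(2) by blast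
  qed
qed

lemma steep_nearI:
  assumes "\<exists>\<^sub>F y in at x. A (min x y, max x y)"
  shows "steep_near A x"
  unfolding steep_near_def
proof (intro allI impI)
  fix d :: real assume "d > 0"
  then obtain y where "y \<noteq> x" "dist y x < d" "A (min x y, max x y)"
    using assms unfolding frequently_def eventually_at by auto
  then show "\<exists>p. fst p < snd p \<and> x \<in> {fst p..snd p} \<and> snd p - fst p < d \<and> A p"
    by (intro exI[of _ "(min x y, max x y)"]) (auto simp: dist_real_def min_def max_def)
qed

lemma incr_quotient:
  "incr g (min x y, max x y) = (g y - g x) / (y - x) * (max x y - min x y)"
  by (cases "x = y") (auto simp: incr_def min_def max_def field_simps)

text \<open>Subtracting the linear function of slope \<open>(r + s) / 2\<close> turns slopes below \<open>r\<close> and above \<open>s\<close> into slopes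
below \<open>- (s - r) / 2\<close> and above \<open>(s - r) / 2\<close>, so that \<open>negligible_crossing\<close> applies.\<close>

lemma negligible_not_differentiable:
  assumes bv: "\<And>P. segs a b P \<Longrightarrow> var g P \<le> B" and "a < b"
  shows "negligible {x\<in>{a<..<b}. \<not> (\<exists>D. (g has_field_derivative D) (at x))}" (is "negligible ?N")
proof -
  define U where "U = {x\<in>{a<..<b}. \<forall>k. steep_near (\<lambda>p. k * (snd p - fst p) < \<bar>incr g p\<bar>) x}"
  define E where "E r s = {x\<in>{a<..<b}.
      steep_near (\<lambda>p. incr (\<lambda>t. g t - (r + s) / 2 * t) p < - ((s - r) / 2) * (snd p - fst p)) x \<and>
      steep_near (\<lambda>p. (s - r) / 2 * (snd p - fst p) < incr (\<lambda>t. g t - (r + s) / 2 * t) p) x}"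
    for r s
  have E: "negligible (E r s)" if "r < s" for r s
    unfolding E_def
  proof (rule negligible_crossing)
    fix P assume P: "segs a b P"
    have "len P \<le> measure lebesgue {a..b}"
      using segs_bounds[OF P] by (intro segs_len_le_measure[OF P]) force+
    then have l: "len P \<le> b - a" using \<open>a < b\<close> by simp
    have "var (\<lambda>t. g t - (r + s) / 2 * t) P \<le> (\<Sum>p\<in>P. \<bar>incr g p\<bar> + \<bar>(r + s) / 2\<bar> * (snd p - fst p))"
    proof (rule sum_mono)
      fix p assume "p \<in> P"
      then have "snd p - fst p \<ge> 0" using segs_bounds[OF P, of p] by simp
      moreover have "incr (\<lambda>t. g t - (r + s) / 2 * t) p = incr g p - (r + s) / 2 * (snd p - fst p)"
        by (simp add: incr_def field_simps)
      moreover have "\<bar>incr g p - (r + s) / 2 * (snd p - fst p)\<bar> \<le> \<bar>incr g p\<bar> + \<bar>(r + s) / 2 * (snd p - fst p)\<bar>"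
        by (rule abs_triangle_ineq4)
      ultimately show "\<bar>incr (\<lambda>t. g t - (r + s) / 2 * t) p\<bar> \<le> \<bar>incr g p\<bar> + \<bar>(r + s) / 2\<bar> * (snd p - fst p)"
        by (simp add: abs_mult)
    qed
    also have "\<dots> = var g P + \<bar>(r + s) / 2\<bar> * len P" by (simp add: sum.distrib sum_distrib_left)
    also have "\<dots> \<le> B + \<bar>(r + s) / 2\<bar> * (b - a)"
      by (intro add_mono bv[OF P] mult_left_mono l) auto
    finally show "var (\<lambda>t. g t - (r + s) / 2 * t) P \<le> B + \<bar>(r + s) / 2\<bar> * (b - a)" .
  qed (use that \<open>a < b\<close> in auto)
  have "?N \<subseteq> U \<union> (\<Union>(r,s)\<in>{(r,s). r \<in> \<rat> \<and> s \<in> \<rat> \<and> r < s}. E r s)"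
  proof
    fix x assume x: "x \<in> ?N"
    let ?q = "\<lambda>y. (g y - g x) / (y - x)"
    have y: "\<forall>\<^sub>F y in at x. max x y - min x y > 0" 
      by (auto simp: eventually_at dist_real_def min_def max_def intro!: exI[of _ 1])
    have "at x \<noteq> bot" by simp
    then show "x \<in> U \<union> (\<Union>(r,s)\<in>{(r,s). r \<in> \<rat> \<and> s \<in> \<rat> \<and> r < s}. E r s)"
    proof (rule converges_or_oscillates[of _ ?q])
      fix D assume "(?q \<longlongrightarrow> D) (at x)"
      then show ?thesis using x by (auto simp: has_field_derivative_iff)
    next
      assume *: "\<And>k. \<exists>\<^sub>F y in at x. k < \<bar>?q y\<bar>"
      have "steep_near (\<lambda>p. k * (snd p - fst p) < \<bar>incr g p\<bar>) x" for k
      proof (rule steep_nearI, rule frequently_elim1[OF frequently_eventually_frequently[OF *[of k] y]])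
        fix y assume "k < \<bar>?q y\<bar> \<and> 0 < max x y - min x y"
        then show "k * (snd (min x y, max x y) - fst (min x y, max x y)) < \<bar>incr g (min x y, max x y)\<bar>"
          unfolding incr_quotient fst_conv snd_conv abs_mult by (metis abs_of_pos mult_less_cancel_right_disj)
      qed
      then show ?thesis using x by (auto simp: U_def)
    next
      fix r s :: real assume rs: "r \<in> \<rat>" "s \<in> \<rat>" "r < s" and
        *: "\<exists>\<^sub>F y in at x. ?q y < r" "\<exists>\<^sub>F y in at x. s < ?q y"
      let ?g = "\<lambda>t. g t - (r + s) / 2 * t"
      have i: "incr ?g p = incr g p - (r + s) / 2 * (snd p - fst p)" for p
        by (simp add: incr_def field_simps)
      have "steep_near (\<lambda>p. incr ?g p < - ((s - r) / 2) * (snd p - fst p)) x"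
      proof (rule steep_nearI, rule frequently_elim1[OF frequently_eventually_frequently[OF *(1) y]])
        fix y assume y: "?q y < r \<and> 0 < max x y - min x y"
        then have "?q y * (max x y - min x y) < r * (max x y - min x y)"
            by (intro mult_strict_right_mono) auto
        then show "incr ?g (min x y, max x y) < - ((s - r) / 2) * (snd (min x y, max x y) - fst (min x y, max x y))"
          unfolding i incr_quotient fst_conv snd_conv by (simp add: algebra_simps add_divide_distrib diff_divide_distrib)
      qed
      moreover have "steep_near (\<lambda>p. (s - r) / 2 * (snd p - fst p) < incr ?g p) x"
      proof (rule steep_nearI, rule frequently_elim1[OF frequently_eventually_frequently[OF *(2) y]])
        fix y assume y: "s < ?q y \<and> 0 < max x y - min x y"
        then have "s * (max x y - min x y) < ?q y * (max x y - min x y)"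
            by (intro mult_strict_right_mono) auto
        then show "(s - r) / 2 * (snd (min x y, max x y) - fst (min x y, max x y)) < incr ?g (min x y, max x y)"
          unfolding i incr_quotient fst_conv snd_conv by (simp add: algebra_simps add_divide_distrib diff_divide_distrib)
      qed
      ultimately have "x \<in> E r s" using x by (auto simp: E_def)
      then show ?thesis using rs by blast
    qed
  qed
  moreover have "negligible (U \<union> (\<Union>(r,s)\<in>{(r,s). r \<in> \<rat> \<and> s \<in> \<rat> \<and> r < s}. E r s))"
  proof (rule negligible_Un)
    show "negligible U" unfolding U_def by (rule negligible_unbounded_slopes[OF bv])
    have "countable {(r,s). r \<in> \<rat> \<and> s \<in> \<rat> \<and> r < (s::real)}"
      by (rule countable_subset[of _ "\<rat> \<times> \<rat>"]) (auto intro: countable_rat)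
    then show "negligible (\<Union>(r,s)\<in>{(r,s). r \<in> \<rat> \<and> s \<in> \<rat> \<and> r < s}. E r s)"
      using E by (intro negligible_countable_Union countable_image) auto
  qed
  ultimately show ?thesis by (rule negligible_subset[rotated])
qed

section \<open>Absolutely continuous functions\<close>

lemma AC_segs:
  assumes "h \<in> AC" "e > 0"
  obtains d where "d > 0" "\<And>P. segs 0 1 P \<Longrightarrow> len P < d \<Longrightarrow> var h P < e"
proof -
  obtain d where d: "d > 0" "\<And>(n::nat) a b. (\<forall>i<n. 0 \<le> a i \<and> a i < b i \<and> b i \<le> 1) \<Longrightarrow>
      disjoint_family_on (\<lambda>i. {a i<..<b i}) {..<n} \<Longrightarrow>
      (\<Sum>i<n. b i - a i) < d \<Longrightarrow> (\<Sum>i<n. \<bar>h (b i) - h (a i)\<bar>) < e"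
    using assms unfolding AC_def by blast
  show ?thesis
  proof (rule that[OF d(1)])
    fix P assume P: "segs 0 1 P" "len P < d"
    obtain f where f: "bij_betw f {..<card P} P"
      using ex_bij_betw_nat_finite[OF segs_finite[OF P(1)]] by (auto simp: atLeast0LessThan)
    have fP: "f i \<in> P" if "i < card P" for i using f that by (auto simp: bij_betw_def)
    have "(\<Sum>i<card P. \<bar>h (snd (f i)) - h (fst (f i))\<bar>) < e"
    proof (rule d(2))
      show "\<forall>i<card P. 0 \<le> fst (f i) \<and> fst (f i) < snd (f i) \<and> snd (f i) \<le> 1"
        using segs_bounds[OF P(1) fP] by blast
      show "disjoint_family_on (\<lambda>i. {fst (f i)<..<snd (f i)}) {..<card P}"
        unfolding disjoint_family_on_def
      proof (intro ballI impI)
        fix i j assume ij: "i \<in> {..<card P}" "j \<in> {..<card P}" "i \<noteq> j"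
        then have "f i \<noteq> f j" using f by (auto simp: bij_betw_def inj_on_def)
        then show "{fst (f i)<..<snd (f i)} \<inter> {fst (f j)<..<snd (f j)} = {}"
          using segs_sep[OF P(1), of "f i" "f j"] fP ij by force
      qed
      show "(\<Sum>i<card P. snd (f i) - fst (f i)) < d"
        using sum.reindex_bij_betw[OF f, of "\<lambda>p. snd p - fst p"] P(2) by simp
    qed
    then show "var h P < e"
      using sum.reindex_bij_betw[OF f, of "\<lambda>p. \<bar>incr h p\<bar>"] by (simp add: incr_def)
  qed
qed

lemma AC_continuous:
  assumes "h \<in> AC"
  shows "continuous_on {0..1} h"
  unfolding continuous_on_iff
proof (intro ballI allI impI)
  fix x e :: real assume x: "x \<in> {0..1}" and "e > 0"
  then obtain d where d: "d > 0" "\<And>P. segs 0 1 P \<Longrightarrow> len P < d \<Longrightarrow> var h P < e"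
    using AC_segs[OF assms] by blast
  show "\<exists>d>0. \<forall>x'\<in>{0..1}. dist x' x < d \<longrightarrow> dist (h x') (h x) < e"
  proof (intro exI[of _ d] conjI d(1) ballI impI)
    fix x' assume x': "x' \<in> {0..1}" "dist x' x < d"
    show "dist (h x') (h x) < e"
    proof (cases "x' = x")
      case False
      have "var h {(min x x', max x x')} < e"
        using x x' False by (intro d(2) segsI) (auto simp: dist_real_def)
      then show ?thesis by (auto simp: incr_def dist_real_def min_def max_def split: if_splits)
    qed (use \<open>e > 0\<close> in simp)
  qed
qed

text \<open>Absolute continuity bounds the variation by \<open>1\<close> on intervals that are short enough, and finitely
many of these make up the unit interval.\<close>

lemma AC_differentiable_ae:
  assumes "h \<in> AC"
  shows "negligible {x\<in>{0<..<1}. \<not> (\<exists>D. (h has_field_derivative D) (at x))}" (is "negligible ?N")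
proof -
  obtain d where d: "d > 0" "\<And>P. segs 0 1 P \<Longrightarrow> len P < d \<Longrightarrow> var h P < 1"
    using AC_segs[OF assms, of 1] by auto
  obtain n where n: "n > 0" "inverse (real n) < d" using d(1) ex_inverse_of_nat_less by blast
  let ?u = "\<lambda>i. real i / n" and ?v = "\<lambda>i. real (Suc i) / n"
  have neg: "negligible {x\<in>{?u i<..<?v i}. \<not> (\<exists>D. (h has_field_derivative D) (at x))}" if i: "i < n" for i
  proof (rule negligible_not_differentiable)
    fix P assume P: "segs (?u i) (?v i) P"
    have "len P \<le> measure lebesgue {?u i..?v i}"
      using segs_bounds[OF P] by (intro segs_len_le_measure[OF P]) force+
    also have "\<dots> = inverse n" using n by (simp add: field_simps)
    finally have "len P < d" using n by simp
    moreover have "segs 0 1 P"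
    proof (rule segsI)
      fix p assume "p \<in> P"
      moreover have "0 \<le> ?u i" "?v i \<le> 1" using i by auto
      ultimately show "0 \<le> fst p \<and> fst p < snd p \<and> snd p \<le> 1" using segs_bounds[OF P, of p] by linarith
    qed (use segs_finite[OF P] segs_sep[OF P] in auto)
    ultimately show "var h P \<le> 1" using d(2) by force
  qed (use n in \<open>auto simp: field_simps\<close>)
  have "?N \<subseteq> (\<Union>i<n. {x\<in>{?u i<..<?v i}. \<not> (\<exists>D. (h has_field_derivative D) (at x))}) \<union> ?u ` {..<n}"
  proof
    fix x assume x: "x \<in> ?N"
    define i where "i = nat \<lfloor>x * n\<rfloor>"
    have xn: "0 \<le> x * n" "x * n < n" using x n by auto
    have "real i \<le> x * n" "x * n < real i + 1" unfolding i_def using xn by linarith+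
    moreover from this have "i < n" using xn by linarith
    ultimately have i: "i < n" "?u i \<le> x" "x < ?v i" using n by (auto simp: field_simps)
    then show "x \<in> (\<Union>i<n. {x\<in>{?u i<..<?v i}. \<not> (\<exists>D. (h has_field_derivative D) (at x))}) \<union> ?u ` {..<n}"
      using x by (cases "x = ?u i") auto
  qed
  moreover have "negligible ((\<Union>i<n. {x\<in>{?u i<..<?v i}. \<not> (\<exists>D. (h has_field_derivative D) (at x))}) \<union> ?u ` {..<n})"
    using neg by (intro negligible_Un negligible_Union) (auto simp del: Collect_mem_eq)
  ultimately show ?thesis by (rule negligible_subset[rotated])
qed

text \<open>A gauge argument. Where \<open>h\<close> is differentiable, the gauge controls the error of the linear
approximation. The remaining null set \<open>N\<close> is enclosed in an open set \<open>U\<close> of small measure, and tags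
in \<open>N\<close> get the gauge \<open>U\<close>: their intervals have small total length, so by absolute continuity the
increments of \<open>h\<close> over them have a small sum.\<close>

lemma AC_fundamental_theorem:
  assumes h: "h \<in> AC" and ab: "0 \<le> a" "a \<le> b" "b \<le> 1"
  shows "(deriv h has_integral (h b - h a)) {a..b}"
proof -
  \<comment> \<open>The values of \<open>h\<close> outside the unit interval are arbitrary, so the endpoints are exceptional too.\<close>
  define N where "N = {x\<in>{0<..<1}. \<not> (\<exists>D. (h has_field_derivative D) (at x))} \<union> {0,1}"
  have N: "negligible N"
    unfolding N_def by (intro negligible_Un AC_differentiable_ae[OF h]) auto
  define f where "f x = (if x \<in> N then 0 else deriv h x)" for x
  have deriv: "(h has_field_derivative f x) (at x)" if "x \<in> {a..b}" "x \<notin> N" for x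
  proof -
    have "x \<in> {0<..<1}" using that ab by (auto simp: N_def)
    then have "\<exists>D. (h has_field_derivative D) (at x)" using that by (auto simp: N_def)
    then show ?thesis using that by (auto simp: f_def DERIV_imp_deriv)
  qed
  have "(f has_integral (h b - h a)) {a..b}"
    unfolding has_integral_real
  proof (intro allI impI)
    fix e :: real assume "e > 0"
    define \<eta> where "\<eta> = e / (2 * (b - a + 1))"
    have \<eta>: "\<eta> > 0" "\<eta> * (b - a) < e / 2"
      using \<open>e > 0\<close> ab by (auto simp: \<eta>_def field_simps)
    obtain d where d: "d > 0" "\<And>P. segs 0 1 P \<Longrightarrow> len P < d \<Longrightarrow> var h P < e / 2"
      using AC_segs[OF h, of "e/2"] \<open>e > 0\<close> by auto
    have "N \<in> sets lebesgue" using N negligible_imp_sets by blast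
    then obtain U where U: "open U" "N \<subseteq> U" "U - N \<in> lmeasurable" "emeasure lebesgue (U - N) < ennreal d"
      using sets_lebesgue_outer_open d(1) by blast
    have "U = (U - N) \<union> N" using U(2) by blast
    then have Um: "U \<in> lmeasurable"
      using fmeasurable.Un[OF U(3) negligible_imp_measurable[OF N]] by simp
    have "measure lebesgue U = measure lebesgue (U - N)"
      using N U(2) by (metis Diff_Un Un_Diff_cancel2 measure_negligible_symdiff fmeasurableD U(3) N \<open>U = (U - N) \<union> N\<close> measure_Un_null_set negligible_iff_null_sets)
    moreover have "measure lebesgue (U - N) < d"
      using U(3,4) d(1) by (simp add: emeasure_eq_measure2 ennreal_less_iff)
    ultimately have Ud: "measure lebesgue U < d" by simp
    have "\<exists>r>0. x \<in> {a..b} - N \<longrightarrow> (\<forall>y. \<bar>y - x\<bar> < r \<longrightarrow> \<bar>h y - h x - f x * (y - x)\<bar> \<le> \<eta> * \<bar>y - x\<bar>)" for x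
    proof (cases "x \<in> {a..b} - N")
      case True
      then have "(h has_derivative (*) (f x)) (at x within UNIV)"
        using deriv[of x] by (auto simp: has_field_derivative_def)
      then show ?thesis unfolding has_derivative_within_alt using \<eta>(1) by auto
    qed (auto intro: exI[of _ 1])
    then obtain r where r: "\<And>x. r x > 0" 
      "\<And>x y. x \<in> {a..b} \<Longrightarrow> x \<notin> N \<Longrightarrow> \<bar>y - x\<bar> < r x \<Longrightarrow> \<bar>h y - h x - f x * (y - x)\<bar> \<le> \<eta> * \<bar>y - x\<bar>"
      by (metis Diff_iff)
    define \<gamma> where "\<gamma> x = (if x \<in> N then U else ball x (r x))" for x
    show "\<exists>\<gamma>. gauge \<gamma> \<and> (\<forall>\<D>. \<D> tagged_division_of {a..b} \<and> \<gamma> fine \<D> \<longrightarrow>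
        norm ((\<Sum>(x, k)\<in>\<D>. measure lborel k *\<^sub>R f x) - (h b - h a)) < e)"
    proof (intro exI[of _ \<gamma>] conjI allI impI)
      show "gauge \<gamma>" using U(1,2) r(1) by (auto simp: gauge_def \<gamma>_def)
      fix \<D> assume "\<D> tagged_division_of {a..b} \<and> \<gamma> fine \<D>"
      then have D: "\<D> tagged_division_of {a..b}" and fine: "\<gamma> fine \<D>" by auto
      have fin: "finite \<D>" using D by blast
      have kk: "k = {Inf k..Sup k} \<and> Inf k \<le> x \<and> x \<le> Sup k \<and> a \<le> Inf k \<and> Sup k \<le> b \<and>
          measure lborel k = Sup k - Inf k \<and> x \<in> {a..b}"
        if xk: "(x, k) \<in> \<D>" for x k
      proof -
        obtain u v where uv: "k = cbox u v" using tagged_division_ofD(4)[OF D xk] by blast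
        have "x \<in> k" "k \<subseteq> {a..b}" using tagged_division_ofD(2,3)[OF D xk] by auto
        then show ?thesis by (auto simp: uv)
      qed
      define T where "T z = measure lborel (snd z) * f (fst z) - (h (Sup (snd z)) - h (Inf (snd z)))" for z
      define DN where "DN = {z\<in>\<D>. fst z \<in> N}"
      have DN: "finite DN" using fin by (simp add: DN_def)
      have "(\<Sum>(x, k)\<in>\<D>. measure lborel k *\<^sub>R f x) - (h b - h a) = sum T \<D>"
        using additive_tagged_division_1[OF ab(2) D, of h]
        by (simp add: T_def sum_subtractf split_beta)
      also have "\<dots> = sum T (\<D> - DN) + sum T DN"
        using fin by (simp add: sum.subset_diff[of DN \<D>] DN_def)
      finally have eq: "(\<Sum>(x, k)\<in>\<D>. measure lborel k *\<^sub>R f x) - (h b - h a) = sum T (\<D> - DN) + sum T DN" .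
      have "\<bar>sum T (\<D> - DN)\<bar> \<le> (\<Sum>z\<in>\<D> - DN. \<bar>T z\<bar>)" by (rule sum_abs)
      also have "\<dots> \<le> (\<Sum>z\<in>\<D> - DN. \<eta> * measure lborel (snd z))"
      proof (rule sum_mono)
        fix z assume "z \<in> \<D> - DN"
        then obtain x k where z: "z = (x,k)" "(x,k) \<in> \<D>" "x \<notin> N" by (cases z) (auto simp: DN_def)
        note K = kk[OF z(2)]
        then have c: "measure lborel k = Sup k - Inf k" by blast
        have "k \<subseteq> ball x (r x)" using fineD[OF fine z(2)] z(3) by (simp add: \<gamma>_def)
        moreover have "Inf k \<in> k" "Sup k \<in> k" using K by (metis atLeastAtMost_iff order_refl order_trans)+
        ultimately have "\<bar>Inf k - x\<bar> < r x" "\<bar>Sup k - x\<bar> < r x" by (auto simp: dist_real_def subset_iff)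
        then have "\<bar>h (Inf k) - h x - f x * (Inf k - x)\<bar> \<le> \<eta> * \<bar>Inf k - x\<bar>"
            "\<bar>h (Sup k) - h x - f x * (Sup k - x)\<bar> \<le> \<eta> * \<bar>Sup k - x\<bar>"
          using r(2) K z(3) by blast+
        moreover have "T z = (h (Inf k) - h x - f x * (Inf k - x)) - (h (Sup k) - h x - f x * (Sup k - x))"
          unfolding T_def z(1) fst_conv snd_conv c by (simp add: algebra_simps)
        moreover have "\<eta> * measure lborel k = \<eta> * \<bar>Inf k - x\<bar> + \<eta> * \<bar>Sup k - x\<bar>"
          unfolding c using K by (simp add: algebra_simps)
        ultimately show "\<bar>T z\<bar> \<le> \<eta> * measure lborel (snd z)" by (simp add: z(1))
      qed
      also have "\<dots> \<le> (\<Sum>z\<in>\<D>. \<eta> * measure lborel (snd z))"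
        using fin \<eta>(1) by (intro sum_mono2) auto
      also have "\<dots> = \<eta> * (b - a)"
        using additive_content_tagged_division[of \<D> a b] D ab
        by (simp add: sum_distrib_left[symmetric] split_beta)
      also have "\<dots> < e / 2" by (rule \<eta>)
      finally have 1: "\<bar>sum T (\<D> - DN)\<bar> < e / 2" .
      \<comment> \<open>Tags with an interval of length \<open>0\<close> contribute nothing, and dropping them makes \<open>?i\<close> injective.\<close>
      define DP where "DP = {z\<in>DN. Inf (snd z) < Sup (snd z)}"
      let ?i = "\<lambda>z::real \<times> real set. (Inf (snd z), Sup (snd z))"
      have inj: "inj_on ?i DP"
      proof (rule inj_onI)
        fix z z' assume z: "z \<in> DP" "z' \<in> DP" "?i z = ?i z'"
        obtain x k where xk: "z = (x,k)" by (cases z)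
        obtain x' k' where xk': "z' = (x',k')" by (cases z')
        have mem: "(x,k) \<in> \<D>" "(x',k') \<in> \<D>" using z xk xk' by (auto simp: DP_def DN_def)
        have keq: "k = k'" using kk[OF mem(1)] kk[OF mem(2)] z(3) xk xk' by (metis fst_conv snd_conv)
        have "interior k \<noteq> {}"
          using kk[OF mem(1)] z(1) xk by (auto simp: DP_def) (metis interior_atLeastAtMost_real greaterThanLessThan_empty_iff not_le)
        then show "z = z'" using tagged_division_ofD(5)[OF D mem] keq xk xk' by auto
      qed
      have mem: "(fst z, snd z) \<in> \<D>" "fst z \<in> N" "Inf (snd z) < Sup (snd z)" if "z \<in> DP" for z
        using that by (auto simp: DP_def DN_def)
      have sg: "segs 0 1 (?i ` DP)"
      proof (rule segsI)
        show "finite (?i ` DP)" using DN by (simp add: DP_def)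
        show "0 \<le> fst p \<and> fst p < snd p \<and> snd p \<le> 1" if p: "p \<in> ?i ` DP" for p
        proof -
          obtain z where z: "z \<in> DP" "p = ?i z" using p by blast
          show ?thesis using kk[OF mem(1)[OF z(1)]] mem(3)[OF z(1)] ab z(2) by simp
        qed
        show "snd p \<le> fst q \<or> snd q \<le> fst p" if pq: "p \<in> ?i ` DP" "q \<in> ?i ` DP" "p \<noteq> q" for p q
        proof (rule ccontr)
          assume c: "\<not> ?thesis"
          obtain z z' where z: "z \<in> DP" "p = ?i z" "z' \<in> DP" "q = ?i z'" using pq by blast
          have "(fst z, snd z) \<noteq> (fst z', snd z')" using pq z by auto
          then have "interior (snd z) \<inter> interior (snd z') = {}"
            using tagged_division_ofD(5)[OF D mem(1)[OF z(1)] mem(1)[OF z(3)]] by auto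
          then have "{fst p<..<snd p} \<inter> {fst q<..<snd q} = {}"
            using kk[OF mem(1)[OF z(1)]] kk[OF mem(1)[OF z(3)]] z(2,4)
            by (metis fst_conv snd_conv interior_atLeastAtMost_real)
          moreover have "max (fst p) (fst q) < min (snd p) (snd q)"
            using c mem(3)[OF z(1)] mem(3)[OF z(3)] z by auto
          then obtain w where "max (fst p) (fst q) < w" "w < min (snd p) (snd q)" using dense by blast
          then have "w \<in> {fst p<..<snd p} \<inter> {fst q<..<snd q}" by auto
          ultimately show False by blast
        qed
      qed
      have "len (?i ` DP) \<le> measure lebesgue U"
      proof (rule segs_len_le_measure[OF sg _ Um])
        fix p assume "p \<in> ?i ` DP"
        then obtain z where z: "z \<in> DP" "p = ?i z" by blast
        have "snd z \<subseteq> U" using fineD[OF fine mem(1)[OF z(1)]] mem(2)[OF z(1)] by (simp add: \<gamma>_def)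
        moreover have "{fst p<..<snd p} \<subseteq> snd z" using kk[OF mem(1)[OF z(1)]] z(2)
          by (metis fst_conv snd_conv greaterThanLessThan_subseteq_atLeastAtMost_iff order_refl)
        ultimately show "{fst p<..<snd p} \<subseteq> U" by blast
      qed
      then have "var h (?i ` DP) < e / 2" using d(2)[OF sg] Ud by simp
      then have v: "(\<Sum>z\<in>DP. \<bar>h (Sup (snd z)) - h (Inf (snd z))\<bar>) < e / 2"
        by (simp add: sum.reindex[OF inj] incr_def)
      have "\<bar>sum T DN\<bar> \<le> (\<Sum>z\<in>DN. \<bar>T z\<bar>)" by (rule sum_abs)
      also have "\<dots> = (\<Sum>z\<in>DP. \<bar>T z\<bar>)"
      proof (rule sum.mono_neutral_right[OF DN])
        show "\<forall>z\<in>DN - DP. \<bar>T z\<bar> = 0"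
        proof
          fix z assume z: "z \<in> DN - DP"
          then have "(fst z, snd z) \<in> \<D>" "fst z \<in> N" "\<not> Inf (snd z) < Sup (snd z)" by (auto simp: DP_def DN_def)
          then have "Inf (snd z) = Sup (snd z)" using kk[of "fst z" "snd z"] by linarith
          then show "\<bar>T z\<bar> = 0" using \<open>fst z \<in> N\<close> by (simp add: T_def f_def)
        qed
      qed (auto simp: DP_def)
      also have "\<dots> = (\<Sum>z\<in>DP. \<bar>h (Sup (snd z)) - h (Inf (snd z))\<bar>)"
        using mem(2) by (intro sum.cong) (auto simp: T_def f_def)
      finally have 2: "\<bar>sum T DN\<bar> < e / 2" using v by simp
      show "norm ((\<Sum>(x, k)\<in>\<D>. measure lborel k *\<^sub>R f x) - (h b - h a)) < e"
        unfolding eq using 1 2 by simp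
    qed
  qed
  then show ?thesis
    by (rule has_integral_spike[OF N, rotated]) (auto simp: f_def)
qed

section \<open>Lower bounds for the energy\<close>

text \<open>Cauchy-Schwarz, obtained by integrating \<open>2 c f - c\<^sup>2 \<le> f\<^sup>2\<close> for the constant \<open>c = J / l\<close>.\<close>

lemma square_integral_ge:
  fixes f :: "real \<Rightarrow> real"
  assumes f: "(f has_integral J) {a..b}" and f2: "((\<lambda>t. (f t)\<^sup>2) has_integral E) {a..b}"
    and l: "a \<le> b" "b - a \<le> l" "l > 0"
  shows "J\<^sup>2 / l \<le> E"
proof -
  define c where "c = J / l"
  have "((\<lambda>t. 2 * c * f t - c\<^sup>2) has_integral (2 * c * J - c\<^sup>2 * (b - a))) {a..b}"
    using has_integral_diff[OF has_integral_mult_right[OF f, of "2*c"] has_integral_const_real[of "c\<^sup>2" a b]] l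
    by (simp add: mult.commute)
  then have "2 * c * J - c\<^sup>2 * (b - a) \<le> E"
  proof (rule has_integral_le[OF _ f2])
    show "2 * c * f t - c\<^sup>2 \<le> (f t)\<^sup>2" for t
      using zero_le_power2[of "f t - c"] by (simp add: power2_diff algebra_simps)
  qed
  moreover have "c\<^sup>2 * (b - a) \<le> c\<^sup>2 * l" using l by (intro mult_left_mono) auto
  moreover have "2 * c * J - c\<^sup>2 * l = J\<^sup>2 / l" using l by (simp add: c_def power2_eq_square field_simps)
  ultimately show ?thesis by linarith
qed

text \<open>Completing a measure leaves the nonnegative integral of every function unchanged. So the energy may
be computed with respect to the completed measure, for which \<open>deriv h\<close> is measurable because it is
integrable in the sense of Henstock and Kurzweil.\<close>

lemma energy_finite_has_integral:
  assumes h: "h \<in> AC" and fin: "energy h \<noteq> \<infinity>"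
  obtains E where "((\<lambda>t. (deriv h t)\<^sup>2) has_integral E) {0..1}" "energy h = ennreal E"
proof -
  have "(deriv h has_integral (h 1 - h 0)) {0..1}" by (rule AC_fundamental_theorem[OF h]) auto
  then have m: "(\<lambda>t. deriv h t * indicator {0..1} t) \<in> lebesgue \<rightarrow>\<^sub>M borel"
    by (rule has_integral_implies_lebesgue_measurable_real)
  define f where "f t = (deriv h t * indicator {0..1} t)\<^sup>2" for t
  have fm: "f \<in> lebesgue \<rightarrow>\<^sub>M borel" unfolding f_def using m by measurable
  have eq: "energy h = integral\<^sup>N lebesgue f"
    unfolding energy_def nn_integral_completion
    by (intro nn_integral_cong) (auto simp: f_def indicator_def)
  obtain E where E: "energy h = ennreal E" "E \<ge> 0" using fin by (cases "energy h") auto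
  have "(f has_integral E) UNIV"
    using has_integral_iff_nn_integral_lebesgue[of f E] fm eq E by (auto simp: f_def)
  moreover have "f = (\<lambda>t. if t \<in> {0..1} then (deriv h t)\<^sup>2 else 0)" by (auto simp: f_def indicator_def)
  ultimately have "((\<lambda>t. (deriv h t)\<^sup>2) has_integral E) {0..1}"
    using has_integral_restrict_UNIV[of "{0..1}" "\<lambda>t. (deriv h t)\<^sup>2" E] by simp
  then show ?thesis using that E by blast
qed

text \<open>Cauchy-Schwarz on the interval between \<open>s i\<close> and \<open>t i\<close>, whose length is at most \<open>1 / n\<close>. These
intervals do not overlap, so the bounds add up.\<close>

lemma energy_ge_sum_squares:
  fixes n :: nat and s t :: "nat \<Rightarrow> real" and h :: "real \<Rightarrow> real"
  assumes h: "h \<in> AC" and n: "n > 0"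
    and st: "\<And>i. i < n \<Longrightarrow> s i \<in> {i / n..(i + 1) / n}" "\<And>i. i < n \<Longrightarrow> t i \<in> {i / n..(i + 1) / n}"
  shows "ennreal (n * (\<Sum>i<n. (h (t i) - h (s i))\<^sup>2)) \<le> energy h"
proof (cases "energy h = \<infinity>")
  case False
  obtain E where E: "((\<lambda>t. (deriv h t)\<^sup>2) has_integral E) {0..1}" "energy h = ennreal E"
    using energy_finite_has_integral[OF h False] by blast
  let ?f = "\<lambda>t. (deriv h t)\<^sup>2"
  have int: "?f integrable_on {a..b}" if "0 \<le> a" "b \<le> 1" for a b
    by (rule integrable_on_subinterval[OF has_integral_integrable[OF E(1)]]) (use that in auto)
  have piece: "n * (h (t i) - h (s i))\<^sup>2 \<le> integral {real i / n..real (Suc i) / n} ?f" if i: "i < n" for i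
  proof -
    define a where "a = min (s i) (t i)"
    define b where "b = max (s i) (t i)"
    have ab: "real i / n \<le> a" "a \<le> b" "b \<le> real (Suc i) / n"
      using st[OF i] by (auto simp: a_def b_def add.commute)
    have i0: "0 \<le> real i / n" "real (Suc i) / n \<le> 1" "real (Suc i) / n - real i / n = 1 / n"
      using i n by (auto simp: field_simps)
    have "(deriv h has_integral (h b - h a)) {a..b}"
      using ab i0 by (intro AC_fundamental_theorem[OF h]) linarith+
    moreover have "(?f has_integral integral {a..b} ?f) {a..b}"
      using int[of a b] ab i0 by (intro integrable_integral) linarith
    ultimately have "(h b - h a)\<^sup>2 / (1 / n) \<le> integral {a..b} ?f"
      by (rule square_integral_ge) (use ab i0 n in auto)
    also have "\<dots> \<le> integral {real i / n..real (Suc i) / n} ?f"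
    proof (rule integral_subset_le)
      have "0 \<le> a" "b \<le> 1" using ab i0 by linarith+
      then show "?f integrable_on {a..b}" "?f integrable_on {real i / n..real (Suc i) / n}"
        using i0 by (auto intro!: int)
    qed (use ab in auto)
    finally show ?thesis by (auto simp: a_def b_def min_def max_def power2_commute mult.commute split: if_splits)
  qed
  have "(\<Sum>i<k. n * (h (t i) - h (s i))\<^sup>2) \<le> integral {0..real k / n} ?f" if "k \<le> n" for k
    using that
  proof (induction k)
    case (Suc k)
    have "real (Suc k) / n \<le> 1" using Suc.prems n by simp
    then have "integral {0..real k / n} ?f + integral {real k / n..real (Suc k) / n} ?f = integral {0..real (Suc k) / n} ?f"
      by (intro Henstock_Kurzweil_Integration.integral_combine int) (auto intro: divide_right_mono)
    then show ?case using Suc piece[of k] by simp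
  qed simp
  from this[of n] have "n * (\<Sum>i<n. (h (t i) - h (s i))\<^sup>2) \<le> E"
    using n integral_unique[OF E(1)] by (simp add: sum_distrib_left)
  then show ?thesis using E(2) by (simp add: ennreal_leI)
qed simp

lemma deviation_from_tube:
  assumes h: "h \<in> AC" and w: "continuous_on {0..1} w" and e: "sup_norm (\<lambda>t. h t - w t) \<le> \<epsilon>"
    and t: "t \<in> {0..1}"
  shows "\<bar>h t - w t\<bar> \<le> \<epsilon>"
proof -
  have "continuous_on {0..1} (\<lambda>t. \<bar>h t - w t\<bar>)"
    using AC_continuous[OF h] w by (intro continuous_intros)
  then have "compact ((\<lambda>t. \<bar>h t - w t\<bar>) ` {0..1})" by (rule compact_continuous_image) auto
  then have "bdd_above ((\<lambda>t. \<bar>h t - w t\<bar>) ` {0..1})" by (intro bounded_imp_bdd_above compact_imp_bounded)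
  then have "\<bar>h t - w t\<bar> \<le> sup_norm (\<lambda>t. h t - w t)" unfolding sup_norm_def using t by (intro cSUP_upper)
  then show ?thesis using e by simp
qed

text \<open>At each of the two points \<open>s i\<close> and \<open>t i\<close>, a competitor deviates from \<open>w\<close> by at most \<open>\<epsilon>\<close>.\<close>

lemma taut_string_ge:
  fixes n :: nat and s t :: "nat \<Rightarrow> real" and w :: "real \<Rightarrow> real"
  assumes w: "continuous_on {0..1} w" and n: "n > 0"
    and st: "\<And>i. i < n \<Longrightarrow> s i \<in> {i / n..(i + 1) / n}" "\<And>i. i < n \<Longrightarrow> t i \<in> {i / n..(i + 1) / n}"
  shows "ennreal (sqrt (n * (\<Sum>i<n. (max (w (t i) - w (s i) - 2 * \<epsilon>) 0)\<^sup>2))) \<le> taut_string w \<epsilon>"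
  unfolding taut_string_def
proof (rule INF_greatest)
  fix h assume "h \<in> {h \<in> AC. sup_norm (\<lambda>t. h t - w t) \<le> \<epsilon> \<and> h 0 = 0}"
  then have h: "h \<in> AC" "sup_norm (\<lambda>t. h t - w t) \<le> \<epsilon>" by auto
  let ?S = "n * (\<Sum>i<n. (max (w (t i) - w (s i) - 2 * \<epsilon>) 0)\<^sup>2)"
  have "?S \<le> n * (\<Sum>i<n. (h (t i) - h (s i))\<^sup>2)"
  proof (intro mult_left_mono sum_mono)
    fix i assume i: "i \<in> {..<n}"
    have "0 \<le> real i / n" "(real i + 1) / n \<le> 1" using i n by auto
    moreover have "real i / n \<le> s i \<and> s i \<le> (real i + 1) / n" "real i / n \<le> t i \<and> t i \<le> (real i + 1) / n"
      using st[of i] i by auto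
    ultimately have "0 \<le> s i \<and> s i \<le> 1" "0 \<le> t i \<and> t i \<le> 1" by linarith+
    then have "\<bar>h (t i) - w (t i)\<bar> \<le> \<epsilon>" "\<bar>h (s i) - w (s i)\<bar> \<le> \<epsilon>"
      using deviation_from_tube[OF h(1) w h(2)] by auto
    then have "\<bar>max (w (t i) - w (s i) - 2 * \<epsilon>) 0\<bar> \<le> \<bar>h (t i) - h (s i)\<bar>" by (auto simp: abs_if max_def split: if_splits)
    then show "(max (w (t i) - w (s i) - 2 * \<epsilon>) 0)\<^sup>2 \<le> (h (t i) - h (s i))\<^sup>2"
      by (rule abs_le_square_iff[THEN iffD1])
  qed simp
  then have le: "ennreal ?S \<le> energy h"
    using energy_ge_sum_squares[OF h(1) n st] by (meson ennreal_leI order_trans)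
  show "ennreal (sqrt ?S) \<le> energy_norm h"
  proof (cases "energy h = \<infinity>")
    case False
    then obtain E where E: "energy h = ennreal E" "E \<ge> 0" by (cases "energy h") auto
    then have "?S \<le> enn2real (energy h)" using le by (simp add: ennreal_le_iff)
    then show ?thesis using False by (simp add: energy_norm_def ennreal_leI)
  qed (simp add: energy_norm_def)
qed

section \<open>Ranges over grids\<close>

text \<open>The range, maximum minus minimum, of the walk with steps \<open>\<xi> 0, \<dots>, \<xi> (m - 1)\<close>, written as a
maximum of differences to keep it visibly measurable.\<close>

definition grid_range :: "nat \<Rightarrow> (nat \<Rightarrow> real) \<Rightarrow> real" where
  "grid_range m \<xi> = Max ((\<lambda>(j,l). sum \<xi> {..<j} - sum \<xi> {..<l}) ` ({..m} \<times> {..m}))"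

lemma grid_range_ge: "j \<le> m \<Longrightarrow> l \<le> m \<Longrightarrow> sum \<xi> {..<j} - sum \<xi> {..<l} \<le> grid_range m \<xi>"
  unfolding grid_range_def by (intro Max_ge) (auto intro!: image_eqI[of _ _ "(j,l)"])

lemma grid_range_attained:
  obtains j l where "j \<le> m" "l \<le> m" "grid_range m \<xi> = sum \<xi> {..<j} - sum \<xi> {..<l}"
proof -
  have "grid_range m \<xi> \<in> (\<lambda>(j,l). sum \<xi> {..<j} - sum \<xi> {..<l}) ` ({..m} \<times> {..m})"
    unfolding grid_range_def by (intro Max_in) auto
  then show ?thesis using that by auto
qed

lemma grid_range_cong: "(\<And>p. p < m \<Longrightarrow> \<xi> p = \<xi>' p) \<Longrightarrow> grid_range m \<xi> = grid_range m \<xi>'"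
  unfolding grid_range_def
  by (intro arg_cong[where f=Max] image_cong refl) (auto intro!: arg_cong2[where f="(-)"] sum.cong)

lemma borel_measurable_grid_range:
  assumes "\<And>p. p < m \<Longrightarrow> X p \<in> borel_measurable N"
  shows "(\<lambda>\<omega>. grid_range m (\<lambda>p. X p \<omega>)) \<in> borel_measurable N"
  unfolding grid_range_def
  by (intro borel_measurable_Max) (auto intro!: borel_measurable_diff borel_measurable_sum assms)

text \<open>The increments of \<open>w\<close> over the grid of \<open>m\<close> steps in the block \<open>[i / n, (i + 1) / n]\<close>, rescaled in such
a way that for a Wiener process their law depends on \<open>m\<close> alone.\<close>

definition block_increment :: "nat \<Rightarrow> nat \<Rightarrow> nat \<Rightarrow> (real \<Rightarrow> real) \<Rightarrow> nat \<Rightarrow> real" where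
  "block_increment n m i w p = sqrt n * (w ((i + real (Suc p) / m) / n) - w ((i + real p / m) / n))"

lemma sum_block_increment:
  "sum (block_increment n m i w) {..<j} = sqrt n * (w ((i + real j / m) / n) - w (real i / n))"
  unfolding block_increment_def sum_distrib_left[symmetric]
  using sum_lessThan_telescope[of "\<lambda>p. w ((i + real p / m) / n)" j] by simp

lemma block_range_attained:
  assumes n: "n > 0" and m: "m > 0"
  obtains s t where "s \<in> {real i / n..(real i + 1) / n}" "t \<in> {real i / n..(real i + 1) / n}"
    "grid_range m (block_increment n m i w) = sqrt n * (w t - w s)"
proof -
  obtain j l where jl: "j \<le> m" "l \<le> m"
      "grid_range m (block_increment n m i w) = sum (block_increment n m i w) {..<j} - sum (block_increment n m i w) {..<l}"
    by (rule grid_range_attained)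
  have mem: "(i + real k / m) / n \<in> {real i / n..(real i + 1) / n}" if "k \<le> m" for k
    using that n m by (auto intro!: divide_right_mono)
  show ?thesis
    by (rule that[OF mem[OF jl(2)] mem[OF jl(1)]])
       (simp add: jl(3) sum_block_increment right_diff_distrib)
qed

lemma grid_time_in_unit_interval:
  fixes n m i k :: nat
  assumes n: "n > 0" and m: "m > 0" and i: "i < n" and k: "k \<le> m"
  shows "(i + real k / m) / n \<in> {0..1}"
proof -
  have "real k / m \<le> 1" using k m by simp
  then have "real i + real k / m \<le> n" using i by linarith
  then show ?thesis using n by simp
qed

lemma grid_point_tendsto:
  fixes s :: real
  assumes "s \<in> {0..1}"
  shows "(\<lambda>m. real (nat \<lfloor>s * Suc m\<rfloor>) / Suc m) \<longlonglongrightarrow> s"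
proof (rule tendsto_sandwich)
  show "(\<lambda>m. s - 1 / Suc m) \<longlonglongrightarrow> s" by real_asymp
  show "\<forall>\<^sub>F m in sequentially. s - 1 / Suc m \<le> real (nat \<lfloor>s * Suc m\<rfloor>) / Suc m"
  proof (intro always_eventually allI)
    fix m
    have "s * Suc m - 1 \<le> real (nat \<lfloor>s * Suc m\<rfloor>)" by linarith
    then have "(s * Suc m - 1) / Suc m \<le> real (nat \<lfloor>s * Suc m\<rfloor>) / Suc m" by (rule divide_right_mono) simp
    then show "s - 1 / Suc m \<le> real (nat \<lfloor>s * Suc m\<rfloor>) / Suc m"
      by (simp add: diff_divide_distrib del: of_nat_Suc)
  qed
  show "\<forall>\<^sub>F m in sequentially. real (nat \<lfloor>s * Suc m\<rfloor>) / Suc m \<le> s"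
  proof (intro always_eventually allI)
    fix m
    have "0 \<le> s * Suc m" using assms by (intro mult_nonneg_nonneg) auto
    then have "real (nat \<lfloor>s * Suc m\<rfloor>) \<le> s * Suc m" by linarith
    then show "real (nat \<lfloor>s * Suc m\<rfloor>) / Suc m \<le> s"
      by (simp add: divide_le_eq del: of_nat_Suc)
  qed
qed simp

lemma grid_range_tendsto_range:
  assumes w: "continuous_on {0..1} w"
  shows "(\<lambda>m. grid_range (Suc m) (block_increment 1 (Suc m) 0 w))
    \<longlonglongrightarrow> (SUP s\<in>{0..1}. w s) - (INF t\<in>{0..1}. w t)"
proof -
  obtain s where s: "s \<in> {0..1}" "\<And>u. u \<in> {0..1} \<Longrightarrow> w u \<le> w s"
    using continuous_attains_sup[of "{0..1::real}" w] w by auto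
  obtain t where t: "t \<in> {0..1}" "\<And>u. u \<in> {0..1} \<Longrightarrow> w t \<le> w u"
    using continuous_attains_inf[of "{0..1::real}" w] w by auto
  have S: "(SUP s\<in>{0..1}. w s) = w s" using s by (intro cSup_eq_maximum) auto
  have I: "(INF t\<in>{0..1}. w t) = w t" using t by (intro cInf_eq_minimum) auto
  let ?p = "\<lambda>(u::real) (m::nat). real (nat \<lfloor>u * Suc m\<rfloor>) / Suc m"
  have fl: "nat \<lfloor>u * Suc m\<rfloor> \<le> Suc m" if "u \<in> {0..1}" for u :: real and m
  proof -
    have "u * Suc m \<le> Suc m" using that mult_right_mono[of u 1 "real (Suc m)"] by simp
    then show ?thesis by linarith
  qed
  have lim: "(\<lambda>m. w (?p u m)) \<longlonglongrightarrow> w u" if u: "u \<in> {0..1}" for u :: real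
  proof (rule continuous_on_tendsto_compose[OF w grid_point_tendsto[OF u] u])
    show "\<forall>\<^sub>F m in sequentially. ?p u m \<in> {0..1}"
      using fl[OF u] by (intro always_eventually allI) (simp del: of_nat_Suc add: divide_le_eq)
  qed
  show ?thesis
  proof (rule tendsto_sandwich)
    show "(\<lambda>m. w (?p s m) - w (?p t m)) \<longlonglongrightarrow> (SUP s\<in>{0..1}. w s) - (INF t\<in>{0..1}. w t)"
      unfolding S I by (intro tendsto_diff lim s t)
    show "\<forall>\<^sub>F m in sequentially. w (?p s m) - w (?p t m) \<le> grid_range (Suc m) (block_increment 1 (Suc m) 0 w)"
    proof (intro always_eventually allI)
      fix m
      show "w (?p s m) - w (?p t m) \<le> grid_range (Suc m) (block_increment 1 (Suc m) 0 w)"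
        using grid_range_ge[OF fl[OF s(1), of m] fl[OF t(1), of m], of "block_increment 1 (Suc m) 0 w"]
        unfolding sum_block_increment by (simp del: of_nat_Suc One_nat_def)
    qed
    show "\<forall>\<^sub>F m in sequentially. grid_range (Suc m) (block_increment 1 (Suc m) 0 w)
        \<le> (SUP s\<in>{0..1}. w s) - (INF t\<in>{0..1}. w t)"
    proof (intro always_eventually allI)
      fix m
      obtain u v where uv: "u \<in> {0..1}" "v \<in> {0..1}"
        "grid_range (Suc m) (block_increment 1 (Suc m) 0 w) = w v - w u"
        by (rule block_range_attained[of 1 "Suc m" 0 w]) auto
      show "grid_range (Suc m) (block_increment 1 (Suc m) 0 w) \<le> (SUP s\<in>{0..1}. w s) - (INF t\<in>{0..1}. w t)"
        unfolding S I uv(3) using s(2)[OF uv(2)] t(2)[OF uv(1)] by linarith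
    qed
  qed simp
qed

lemma truncated_range_ge:
  assumes w: "continuous_on {0..1} w"
  shows "w 1 - w 0 - 2 * x \<le> truncated_range w x"
proof -
  have "compact (w ` {0..1})" using w by (rule compact_continuous_image) auto
  then have b: "bounded (w ` {0..1})" by (rule compact_imp_bounded)
  have "w 1 \<le> (SUP s\<in>{0..1}. w s)" using b by (intro cSUP_upper bounded_imp_bdd_above) auto
  moreover have "(INF t\<in>{0..1}. w t) \<le> w 0" using b by (intro cINF_lower bounded_imp_bdd_below) auto
  ultimately show ?thesis by (simp add: truncated_range_def)
qed

text \<open>The tube radius \<open>x / sqrt n\<close> matches the threshold \<open>2 * x\<close> for the rescaled ranges.\<close>

lemma scaled_taut_string_ge:
  fixes n m :: nat and w :: "real \<Rightarrow> real"
  assumes w: "continuous_on {0..1} w" and n: "n > 0" and m: "m > 0" and x: "x > 0"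
  shows "ennreal (sqrt (x\<^sup>2 / n * (\<Sum>i<n. (max (grid_range m (block_increment n m i w) - 2 * x) 0)\<^sup>2)))
    \<le> ennreal (x / sqrt n) * taut_string w (x / sqrt n)"
proof -
  have "\<forall>i. \<exists>s t. s \<in> {real i / n..(real i + 1) / n} \<and> t \<in> {real i / n..(real i + 1) / n} \<and>
    grid_range m (block_increment n m i w) = sqrt n * (w t - w s)"
    using block_range_attained[OF n m] by metis
  then obtain s t where st: "\<And>i. s i \<in> {real i / n..(real i + 1) / n}"
    "\<And>i. t i \<in> {real i / n..(real i + 1) / n}"
    "\<And>i. grid_range m (block_increment n m i w) = sqrt n * (w (t i) - w (s i))"
    by metis
  let ?e = "x / sqrt n"
  let ?S = "\<Sum>i<n. (max (grid_range m (block_increment n m i w) - 2 * x) 0)\<^sup>2"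
  have sn: "sqrt n > 0" "(sqrt n)\<^sup>2 = n" using n by auto
  have "(max (grid_range m (block_increment n m i w) - 2 * x) 0)\<^sup>2 = n * (max (w (t i) - w (s i) - 2 * ?e) 0)\<^sup>2" for i
  proof -
    have "grid_range m (block_increment n m i w) - 2 * x = sqrt n * (w (t i) - w (s i) - 2 * ?e)"
      unfolding st(3) using sn(1) by (simp add: field_simps)
    then have "max (grid_range m (block_increment n m i w) - 2 * x) 0 = sqrt n * max (w (t i) - w (s i) - 2 * ?e) 0"
      using sn(1) by (auto simp: max_def mult_le_0_iff not_le zero_less_mult_iff)
    then show ?thesis by (simp add: power_mult_distrib)
  qed
  then have S: "?S = n * (\<Sum>i<n. (max (w (t i) - w (s i) - 2 * ?e) 0)\<^sup>2)"
    by (simp add: sum_distrib_left)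
  have "sqrt (x\<^sup>2 / n * ?S) = ?e * sqrt ?S"
    using x by (simp add: real_sqrt_mult real_sqrt_divide)
  then have "ennreal (sqrt (x\<^sup>2 / n * ?S)) = ennreal ?e * ennreal (sqrt ?S)"
    by (simp only:) (intro ennreal_mult; use x in \<open>simp add: sum_nonneg\<close>)
  also have "\<dots> \<le> ennreal ?e * taut_string w ?e"
    unfolding S by (intro mult_left_mono taut_string_ge[OF w n]) (use st in auto)
  finally show ?thesis .
qed

lemma deviation_powr_ge:
  assumes "ennreal L \<le> a" "L \<ge> 0"
  shows "ennreal ((max (L - c) 0)\<^sup>2) \<le> deviation_powr 2 a c"
proof (cases "a = \<infinity>")
  case False
  then obtain r where "a = ennreal r" "r \<ge> 0" by (cases a) auto
  then have "L \<le> enn2real a" using assms by (simp add: ennreal_le_iff)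
  then have "\<bar>max (L - c) 0\<bar> \<le> \<bar>enn2real a - c\<bar>" by auto
  then have "(max (L - c) 0)\<^sup>2 \<le> \<bar>enn2real a - c\<bar>\<^sup>2" using abs_le_square_iff by (metis power2_abs)
  also have "\<dots> = \<bar>enn2real a - c\<bar> powr 2" by simp
  finally show ?thesis using False by (simp add: deviation_powr_def ennreal_leI)
qed (simp add: deviation_powr_def)

text \<open>Allows to conclude that \<open>L\<^sup>2\<close> has mean at most \<open>C\<^sup>2\<close> in the limit when only the excess of \<open>L\<close> over
\<open>C\<close> is known to tend to \<open>0\<close> in mean square. The cross term is absorbed by Young's inequality.\<close>

lemma square_le_square_plus_excess:
  fixes L C \<delta> :: real
  assumes "\<delta> > 0" "L \<ge> 0" "C \<ge> 0"
  shows "L\<^sup>2 \<le> (1 + \<delta>) * C\<^sup>2 + (1 + 1 / \<delta>) * (max (L - C) 0)\<^sup>2"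
proof (cases "L \<le> C")
  case True
  then have "L\<^sup>2 \<le> C\<^sup>2" using assms by (simp add: power_mono)
  also have "\<dots> \<le> (1 + \<delta>) * C\<^sup>2" using assms by (simp add: mult_le_cancel_right1)
  finally show ?thesis using True by simp
next
  case False
  define d where "d = L - C"
  have "0 \<le> \<delta> * (C - d / \<delta>)\<^sup>2" using assms by simp
  also have "\<dots> = \<delta> * C\<^sup>2 - 2 * C * d + d\<^sup>2 / \<delta>"
    using assms by (simp add: power2_eq_square field_simps)
  finally have "(C + d)\<^sup>2 \<le> (1 + \<delta>) * C\<^sup>2 + (1 + 1 / \<delta>) * d\<^sup>2"
    by (simp add: power2_sum algebra_simps)
  then show ?thesis using False by (simp add: d_def)
qed

section \<open>Second moment of the truncated range of a Wiener process\<close>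

text \<open>The value of \<open>E Y\<^sub>x\<^sup>2\<close> with the path replaced by a walk with \<open>m\<close> independent normal steps of variance
\<open>1 / m\<close>.\<close>

definition grid_moment :: "nat \<Rightarrow> real \<Rightarrow> ennreal" where
  "grid_moment m x = (\<integral>\<^sup>+\<xi>. ennreal ((max (grid_range m \<xi> - 2 * x) 0)\<^sup>2)
     \<partial>(\<Pi>\<^sub>M p\<in>{..<m}. density lborel (normal_density 0 (sqrt (1 / m)))))"

context standard_wiener_process
begin

lemma borel_measurable_block_increment:
  assumes n: "n > 0" and m: "m > 0" and i: "i < n" and p: "p < m"
  shows "(\<lambda>\<omega>. block_increment n m i (\<lambda>t. W t \<omega>) p) \<in> borel_measurable M"
  unfolding block_increment_def using p grid_time_in_unit_interval[OF n m i]
  by (intro borel_measurable_times borel_measurable_diff random_variable_W) (auto simp del: of_nat_Suc)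

lemma block_increment_distr:
  assumes n: "n > 0" and m: "m > 0" and i: "i < n" and p: "p < m"
  shows "distr M borel (\<lambda>\<omega>. block_increment n m i (\<lambda>t. W t \<omega>) p)
    = density lborel (normal_density 0 (sqrt (1 / m)))"
proof -
  let ?s = "(i + real p / m) / n" and ?t = "(i + real (Suc p) / m) / n"
  let ?X = "\<lambda>\<omega>. W ?t \<omega> - W ?s \<omega>"
  have d: "?t - ?s = 1 / (real n * m)" using n m by (simp add: field_simps)
  have t1: "?t \<le> 1" using grid_time_in_unit_interval[OF n m i, of "Suc p"] p by simp
  have "?t - ?s > 0" unfolding d using n m by simp
  then have st: "?s < ?t" by linarith
  have "distributed M lborel ?X (normal_density 0 (sqrt (?t - ?s)))"
    by (rule normal_increments) (use st t1 in auto)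
  then have "distributed M lborel (\<lambda>\<omega>. 0 + sqrt n * ?X \<omega>)
      (normal_density (0 + sqrt n * 0) (\<bar>sqrt n\<bar> * sqrt (?t - ?s)))"
    by (rule normal_density_affine) (use st n in auto)
  moreover have "\<bar>sqrt n\<bar> * sqrt (?t - ?s) = sqrt (1 / m)"
    unfolding d using n m by (simp add: real_sqrt_mult real_sqrt_divide)
  ultimately have "distributed M lborel (\<lambda>\<omega>. sqrt n * ?X \<omega>) (normal_density 0 (sqrt (1 / m)))"
    by simp
  then have "distr M lborel (\<lambda>\<omega>. sqrt n * ?X \<omega>) = density lborel (normal_density 0 (sqrt (1 / m)))"
    by (simp add: distributed_def)
  then show ?thesis
    unfolding block_increment_def by (subst distr_cong[OF refl sets_lborel[symmetric] refl])
qed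

lemma block_increments_joint_distr:
  assumes n: "n > 0" and m: "m > 0" and i: "i < n"
  shows "distr M (\<Pi>\<^sub>M p\<in>{..<m}. borel) (\<lambda>\<omega>. \<lambda>p\<in>{..<m}. block_increment n m i (\<lambda>t. W t \<omega>) p)
    = (\<Pi>\<^sub>M p\<in>{..<m}. density lborel (normal_density 0 (sqrt (1 / m))))"
proof -
  let ?\<tau> = "\<lambda>p. (i + real p / m) / n"
  let ?X = "\<lambda>p \<omega>. W (?\<tau> (Suc p)) \<omega> - W (?\<tau> p) \<omega>"
  let ?Y = "\<lambda>p \<omega>. block_increment n m i (\<lambda>t. W t \<omega>) p"
  have mono: "mono_on {..m} ?\<tau>" using n m by (intro mono_onI divide_right_mono add_left_mono) auto
  have \<tau>: "?\<tau> ` {..m} \<subseteq> {0..1}"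
    by (rule image_subsetI) (simp only: atMost_iff grid_time_in_unit_interval[OF n m i])
  have "indep_vars (\<lambda>_. borel) ?X {..<m}"
    using independent_increments[OF mono \<tau>] .
  then have "indep_vars (\<lambda>_. borel) (\<lambda>p. (\<lambda>x. sqrt n * x) \<circ> ?X p) {..<m}"
    by (rule indep_vars_compose) auto
  then have "indep_vars (\<lambda>_. borel) ?Y {..<m}" by (simp add: comp_def block_increment_def)
  then have "distr M (\<Pi>\<^sub>M p\<in>{..<m}. borel) (\<lambda>\<omega>. \<lambda>p\<in>{..<m}. ?Y p \<omega>) = (\<Pi>\<^sub>M p\<in>{..<m}. distr M borel (?Y p))"
    using m borel_measurable_block_increment[OF n m i] by (subst indep_vars_iff_distr_eq_PiM'[symmetric]) auto
  also have "\<dots> = (\<Pi>\<^sub>M p\<in>{..<m}. density lborel (normal_density 0 (sqrt (1 / m))))"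
    using block_increment_distr[OF n m i] by (intro PiM_cong) auto
  finally show ?thesis .
qed

lemma borel_measurable_block_range:
  assumes n: "n > 0" and m: "m > 0" and i: "i < n"
  shows "(\<lambda>\<omega>. grid_range m (block_increment n m i (\<lambda>t. W t \<omega>))) \<in> borel_measurable M"
proof -
  have "(\<lambda>\<omega>. grid_range m (\<lambda>p. block_increment n m i (\<lambda>t. W t \<omega>) p)) \<in> borel_measurable M"
    by (intro borel_measurable_grid_range borel_measurable_block_increment n m i)
  then show ?thesis by simp
qed

text \<open>Brownian scaling and stationarity of the increments: the joint law of the rescaled increments in a
block, and with it this mean, is the same for all \<open>n\<close> and \<open>i\<close>.\<close>

lemma nn_integral_block_range:
  assumes n: "n > 0" and m: "m > 0" and i: "i < n"
  shows "(\<integral>\<^sup>+\<omega>. ennreal ((max (grid_range m (block_increment n m i (\<lambda>t. W t \<omega>)) - 2 * x) 0)\<^sup>2) \<partial>M)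
    = grid_moment m x"
proof -
  let ?\<Phi> = "\<lambda>\<xi>. ennreal ((max (grid_range m \<xi> - 2 * x) 0)\<^sup>2)"
  have "(\<lambda>\<xi>. grid_range m (\<lambda>p. \<xi> p)) \<in> borel_measurable (\<Pi>\<^sub>M p\<in>{..<m}. (borel :: real measure))"
    by (rule borel_measurable_grid_range) auto
  then have \<Phi>: "?\<Phi> \<in> borel_measurable (\<Pi>\<^sub>M p\<in>{..<m}. (borel :: real measure))" by measurable
  have Y: "(\<lambda>\<omega>. \<lambda>p\<in>{..<m}. block_increment n m i (\<lambda>t. W t \<omega>) p) \<in> M \<rightarrow>\<^sub>M (\<Pi>\<^sub>M p\<in>{..<m}. borel)"
    using borel_measurable_block_increment[OF n m i] by (intro measurable_restrict) auto
  have "grid_moment m x = (\<integral>\<^sup>+\<omega>. ?\<Phi> (\<lambda>p\<in>{..<m}. block_increment n m i (\<lambda>t. W t \<omega>) p) \<partial>M)"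
    unfolding grid_moment_def block_increments_joint_distr[OF n m i, symmetric]
    by (rule nn_integral_distr[OF Y]) (use \<Phi> in simp)
  also have "\<dots> = (\<integral>\<^sup>+\<omega>. ?\<Phi> (block_increment n m i (\<lambda>t. W t \<omega>)) \<partial>M)"
    by (intro nn_integral_cong arg_cong[where f="\<lambda>r. ennreal ((max (r - 2 * x) 0)\<^sup>2)"] grid_range_cong) simp
  finally show ?thesis ..
qed

text \<open>For every \<open>n\<close> the left-hand side is the mean of \<open>L2\<close>, the square of a measurable lower bound \<open>L\<close> for
the rescaled taut string value. The mean square of the excess of \<open>L\<close> over \<open>C\<close> is at most the mean
square deviation of that value from \<open>C\<close>, which vanishes as \<open>n\<close> tends to infinity.\<close>

lemma grid_moment_le:
  assumes C: "is_taut_string_constant M W C" and m: "m > 0" and x: "x > 0"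
  shows "ennreal (x\<^sup>2) * grid_moment m x \<le> ennreal (C\<^sup>2)"
proof -
  have C0: "C \<ge> 0" using C by (simp add: is_taut_string_constant_def)
  define \<eta> where "\<eta> \<epsilon> = (\<integral>\<^sup>+\<omega>. deviation_powr 2 (ennreal \<epsilon> * taut_string (\<lambda>t. W t \<omega>) \<epsilon>) C \<partial>M)" for \<epsilon>
  have \<eta>: "(\<eta> \<longlongrightarrow> 0) (at_right 0)"
    using C unfolding is_taut_string_constant_def \<eta>_def by force
  let ?Z = "\<lambda>n i \<omega>. (max (grid_range m (block_increment n m i (\<lambda>t. W t \<omega>)) - 2 * x) 0)\<^sup>2"
  have Zm: "?Z n i \<in> borel_measurable M" if "n > 0" "i < n" for n i
    using borel_measurable_block_range[OF that(1) m that(2)] by measurable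
  \<comment> \<open>Taking means in \<open>L\<^sup>2 \<le> (1 + \<delta>) C\<^sup>2 + (1 + 1 / \<delta>) (L - C)\<^sub>+\<^sup>2\<close>.\<close>
  have step: "ennreal (x\<^sup>2) * grid_moment m x \<le> ennreal ((1 + \<delta>) * C\<^sup>2) + ennreal (1 + 1 / \<delta>) * \<eta> (x / sqrt n)"
    if \<delta>: "\<delta> > 0" and n: "n > 0" for \<delta> :: real and n :: nat
  proof -
    define L2 where "L2 \<omega> = x\<^sup>2 / n * (\<Sum>i<n. ?Z n i \<omega>)" for \<omega>
    have L2m: "L2 \<in> borel_measurable M"
      unfolding L2_def using Zm[OF n] by (intro borel_measurable_times borel_measurable_sum) auto
    have L20: "L2 \<omega> \<ge> 0" for \<omega> unfolding L2_def by (intro mult_nonneg_nonneg sum_nonneg) auto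
    let ?D = "\<lambda>\<omega>. (max (sqrt (L2 \<omega>) - C) 0)\<^sup>2"
    have Dm: "?D \<in> borel_measurable M" using L2m by measurable
    have "(\<integral>\<^sup>+\<omega>. ennreal (L2 \<omega>) \<partial>M) = (\<integral>\<^sup>+\<omega>. ennreal (x\<^sup>2 / n) * (\<Sum>i<n. ennreal (?Z n i \<omega>)) \<partial>M)"
      unfolding L2_def by (intro nn_integral_cong, subst ennreal_mult) (auto intro!: sum_nonneg)
    also have "\<dots> = ennreal (x\<^sup>2 / n) * (\<Sum>i<n. \<integral>\<^sup>+\<omega>. ennreal (?Z n i \<omega>) \<partial>M)"
    proof -
      have Ze: "(\<lambda>\<omega>. ennreal (?Z n i \<omega>)) \<in> borel_measurable M" if "i \<in> {..<n}" for i
        by (rule measurable_compose[OF Zm[OF n]]) (use that in auto)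
      then have "(\<lambda>\<omega>. \<Sum>i<n. ennreal (?Z n i \<omega>)) \<in> borel_measurable M"
        by (rule borel_measurable_sum)
      moreover have "(\<integral>\<^sup>+\<omega>. (\<Sum>i<n. ennreal (?Z n i \<omega>)) \<partial>M) = (\<Sum>i<n. \<integral>\<^sup>+\<omega>. ennreal (?Z n i \<omega>) \<partial>M)"
        by (rule nn_integral_sum) (rule Ze)
      ultimately show ?thesis by (simp only: nn_integral_cmult)
    qed
    also have "\<dots> = ennreal (x\<^sup>2 / n) * (of_nat n * grid_moment m x)"
      using nn_integral_block_range[OF n m] by simp
    also have "\<dots> = ennreal (x\<^sup>2) * grid_moment m x"
      using n by (simp add: mult.assoc[symmetric] ennreal_of_nat_eq_real_of_nat ennreal_mult[symmetric])
    finally have "ennreal (x\<^sup>2) * grid_moment m x = (\<integral>\<^sup>+\<omega>. ennreal (L2 \<omega>) \<partial>M)" ..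
    also have "\<dots> \<le> (\<integral>\<^sup>+\<omega>. ennreal ((1 + \<delta>) * C\<^sup>2) + ennreal (1 + 1 / \<delta>) * ennreal (?D \<omega>) \<partial>M)"
    proof (rule nn_integral_mono)
      fix \<omega>
      have "L2 \<omega> \<le> (1 + \<delta>) * C\<^sup>2 + (1 + 1 / \<delta>) * ?D \<omega>"
        using square_le_square_plus_excess[OF \<delta> _ C0, of "sqrt (L2 \<omega>)"] L20[of \<omega>] by simp
      then have "ennreal (L2 \<omega>) \<le> ennreal ((1 + \<delta>) * C\<^sup>2 + (1 + 1 / \<delta>) * ?D \<omega>)" by (rule ennreal_leI)
      also have "\<dots> = ennreal ((1 + \<delta>) * C\<^sup>2) + ennreal (1 + 1 / \<delta>) * ennreal (?D \<omega>)"
        using \<delta> by (simp add: ennreal_plus[symmetric] ennreal_mult[symmetric] del: ennreal_plus)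
      finally show "ennreal (L2 \<omega>) \<le> ennreal ((1 + \<delta>) * C\<^sup>2) + ennreal (1 + 1 / \<delta>) * ennreal (?D \<omega>)" .
    qed
    also have "\<dots> = ennreal ((1 + \<delta>) * C\<^sup>2) + ennreal (1 + 1 / \<delta>) * (\<integral>\<^sup>+\<omega>. ennreal (?D \<omega>) \<partial>M)"
      using Dm by (simp add: nn_integral_add nn_integral_cmult emeasure_space_1)
    also have "\<dots> \<le> ennreal ((1 + \<delta>) * C\<^sup>2) + ennreal (1 + 1 / \<delta>) * \<eta> (x / sqrt n)"
    proof (intro add_left_mono mult_left_mono)
      show "(\<integral>\<^sup>+\<omega>. ennreal (?D \<omega>) \<partial>M) \<le> \<eta> (x / sqrt n)"
        unfolding \<eta>_def
      proof (rule nn_integral_mono)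
        fix \<omega> assume "\<omega> \<in> space M"
        then have "ennreal (sqrt (L2 \<omega>)) \<le> ennreal (x / sqrt n) * taut_string (\<lambda>t. W t \<omega>) (x / sqrt n)"
          unfolding L2_def by (intro scaled_taut_string_ge continuous_paths n m x)
        then show "ennreal (?D \<omega>) \<le> deviation_powr 2 (ennreal (x / sqrt n) * taut_string (\<lambda>t. W t \<omega>) (x / sqrt n)) C"
          by (rule deviation_powr_ge) (simp add: L20)
      qed
    qed simp
    finally show ?thesis .
  qed
  have lim: "(\<lambda>n. \<eta> (x / sqrt (Suc n))) \<longlonglongrightarrow> 0"
  proof (rule filterlim_compose[OF \<eta>])
    have "(\<lambda>n. x / sqrt (Suc n)) \<longlonglongrightarrow> 0" by real_asymp
    then show "filterlim (\<lambda>n. x / sqrt (Suc n)) (at_right 0) sequentially"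
      using x by (auto simp: filterlim_at)
  qed
  have bound: "ennreal (x\<^sup>2) * grid_moment m x \<le> ennreal ((1 + \<delta>) * C\<^sup>2)" if \<delta>: "\<delta> > 0" for \<delta>
  proof -
    have "(\<lambda>n. ennreal ((1 + \<delta>) * C\<^sup>2) + ennreal (1 + 1 / \<delta>) * \<eta> (x / sqrt (Suc n)))
        \<longlonglongrightarrow> ennreal ((1 + \<delta>) * C\<^sup>2) + ennreal (1 + 1 / \<delta>) * 0"
      by (intro tendsto_add tendsto_const ennreal_tendsto_cmult lim) simp
    then show ?thesis
      using step[OF \<delta>, of "Suc _"] by (intro LIMSEQ_le_const[where x="ennreal ((1 + \<delta>) * C\<^sup>2)"]) auto
  qed
  have "((\<lambda>\<delta>. ennreal ((1 + \<delta>) * C\<^sup>2)) \<longlongrightarrow> ennreal ((1 + 0) * C\<^sup>2)) (at_right 0)"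
    by (intro tendsto_ennrealI tendsto_intros)
  then have "ennreal (x\<^sup>2) * grid_moment m x \<le> ennreal ((1 + 0) * C\<^sup>2)"
    by (rule tendsto_lowerbound)
       (auto intro!: bound eventually_at_right_less[THEN eventually_mono])
  then show ?thesis by simp
qed

lemma truncated_grid_range_tendsto:
  assumes "\<omega> \<in> space M"
  shows "(\<lambda>m. max (grid_range (Suc m) (block_increment 1 (Suc m) 0 (\<lambda>t. W t \<omega>)) - 2 * x) 0)
    \<longlonglongrightarrow> truncated_range (\<lambda>t. W t \<omega>) x"
  unfolding truncated_range_def
  by (intro tendsto_intros grid_range_tendsto_range continuous_paths assms)

lemma borel_measurable_truncated_grid_range:
  assumes "m > 0"
  shows "(\<lambda>\<omega>. max (grid_range m (block_increment 1 m 0 (\<lambda>t. W t \<omega>)) - 2 * x) 0) \<in> borel_measurable M"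
  using borel_measurable_block_range[of 1 m 0] assms by measurable

lemma borel_measurable_truncated_range:
  "(\<lambda>\<omega>. truncated_range (\<lambda>t. W t \<omega>) x) \<in> borel_measurable M"
  by (rule borel_measurable_LIMSEQ_real[OF truncated_grid_range_tendsto borel_measurable_truncated_grid_range]) auto

text \<open>By continuity of the paths the ranges over grids converge to the range, and Fatou's lemma applies.\<close>

lemma truncated_range_moment_le:
  assumes C: "is_taut_string_constant M W C" and x: "x > 0"
  shows "ennreal (x\<^sup>2) * (\<integral>\<^sup>+\<omega>. ennreal ((truncated_range (\<lambda>t. W t \<omega>) x)\<^sup>2) \<partial>M) \<le> ennreal (C\<^sup>2)"
proof -
  let ?Z = "\<lambda>m \<omega>. ennreal ((max (grid_range (Suc m) (block_increment 1 (Suc m) 0 (\<lambda>t. W t \<omega>)) - 2 * x) 0)\<^sup>2)"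
  have Zm: "?Z m \<in> borel_measurable M" for m
    using borel_measurable_truncated_grid_range[of "Suc m" x] by measurable
  have "ennreal (x\<^sup>2) * (\<integral>\<^sup>+\<omega>. ennreal ((truncated_range (\<lambda>t. W t \<omega>) x)\<^sup>2) \<partial>M)
    = (\<integral>\<^sup>+\<omega>. ennreal (x\<^sup>2) * ennreal ((truncated_range (\<lambda>t. W t \<omega>) x)\<^sup>2) \<partial>M)"
    using borel_measurable_truncated_range[of x] by (intro nn_integral_cmult[symmetric]) measurable
  also have "\<dots> = (\<integral>\<^sup>+\<omega>. liminf (\<lambda>m. ennreal (x\<^sup>2) * ?Z m \<omega>) \<partial>M)"
  proof (rule nn_integral_cong)
    fix \<omega> assume "\<omega> \<in> space M"
    have "(\<lambda>m. ennreal (x\<^sup>2) * ?Z m \<omega>) \<longlonglongrightarrow> ennreal (x\<^sup>2) * ennreal ((truncated_range (\<lambda>t. W t \<omega>) x)\<^sup>2)"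
      by (intro ennreal_tendsto_cmult tendsto_ennrealI tendsto_power truncated_grid_range_tendsto \<open>\<omega> \<in> space M\<close>) simp
    then show "ennreal (x\<^sup>2) * ennreal ((truncated_range (\<lambda>t. W t \<omega>) x)\<^sup>2) = liminf (\<lambda>m. ennreal (x\<^sup>2) * ?Z m \<omega>)"
      by (simp add: lim_imp_Liminf)
  qed
  also have "\<dots> \<le> liminf (\<lambda>m. \<integral>\<^sup>+\<omega>. ennreal (x\<^sup>2) * ?Z m \<omega> \<partial>M)"
    by (intro nn_integral_liminf borel_measurable_times_ennreal borel_measurable_const Zm)
  also have "\<dots> = liminf (\<lambda>m. ennreal (x\<^sup>2) * grid_moment (Suc m) x)"
    unfolding nn_integral_cmult[OF Zm]
    by (subst nn_integral_block_range) simp_all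
  also have "\<dots> \<le> liminf (\<lambda>m. ennreal (C\<^sup>2))"
    by (intro Liminf_mono always_eventually allI grid_moment_le[OF C _ x]) simp
  also have "\<dots> = ennreal (C\<^sup>2)" by (rule Liminf_const) simp
  finally show ?thesis .
qed

text \<open>Otherwise \<open>W 1 - W 0\<close> would almost surely be at most \<open>2 * x\<close>, but a normal variable is unbounded.\<close>

lemma truncated_range_moment_nonzero:
  "(\<integral>\<^sup>+\<omega>. ennreal ((truncated_range (\<lambda>t. W t \<omega>) x)\<^sup>2) \<partial>M) \<noteq> 0"
proof
  assume "(\<integral>\<^sup>+\<omega>. ennreal ((truncated_range (\<lambda>t. W t \<omega>) x)\<^sup>2) \<partial>M) = 0"
  moreover have "(\<lambda>\<omega>. ennreal ((truncated_range (\<lambda>t. W t \<omega>) x)\<^sup>2)) \<in> borel_measurable M"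
    using borel_measurable_truncated_range[of x] by measurable
  ultimately have "AE \<omega> in M. ennreal ((truncated_range (\<lambda>t. W t \<omega>) x)\<^sup>2) = 0"
    by (simp add: nn_integral_0_iff_AE)
  then have "AE \<omega> in M. W 1 \<omega> - W 0 \<omega> \<le> 2 * x"
  proof (rule AE_mp, intro AE_I2 impI)
    fix \<omega> assume "\<omega> \<in> space M" "ennreal ((truncated_range (\<lambda>t. W t \<omega>) x)\<^sup>2) = 0"
    then show "W 1 \<omega> - W 0 \<omega> \<le> 2 * x"
      using truncated_range_ge[OF continuous_paths, of \<omega> x] by simp
  qed
  moreover have "distributed M lborel (\<lambda>\<omega>. W 1 \<omega> - W 0 \<omega>) (normal_density 0 (sqrt (1 - 0)))"
    by (rule normal_increments) auto
  ultimately have "AE y in lborel. 0 < ennreal (normal_density 0 (sqrt (1 - 0)) y) \<longrightarrow> y \<le> 2 * x"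
    by (subst (asm) distributed_AE2) auto
  then have "AE y in lborel. y \<le> 2 * x" by (simp add: normal_density_pos)
  then have "emeasure lborel {y. \<not> y \<le> 2 * x} = 0" by (subst (asm) AE_iff_measurable[OF _ refl]) auto
  moreover have "emeasure lborel {2 * x<..<2 * x + 1} \<le> emeasure lborel {y. \<not> y \<le> 2 * x}"
    by (intro emeasure_mono) auto
  ultimately show False by simp
qed

end

theorem mainTheorem5:
  fixes M :: "'a measure" and W :: "real \<Rightarrow> 'a \<Rightarrow> real" and C x :: real
  assumes "standard_wiener_process M W"
    and "is_taut_string_constant M W C"
    and "x > 0"
  shows "C\<^sup>2 \<ge> x\<^sup>2 * (\<integral>\<omega>. (truncated_range (\<lambda>t. W t \<omega>) x)\<^sup>2 \<partial>M)
    \<and> x\<^sup>2 * (\<integral>\<omega>. (truncated_range (\<lambda>t. W t \<omega>) x)\<^sup>2 \<partial>M) > 0"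
proof -
  interpret standard_wiener_process M W by (rule assms(1))
  let ?Y2 = "\<lambda>\<omega>. (truncated_range (\<lambda>t. W t \<omega>) x)\<^sup>2"
  let ?K = "\<integral>\<^sup>+\<omega>. ennreal (?Y2 \<omega>) \<partial>M"
  have le: "ennreal (x\<^sup>2) * ?K \<le> ennreal (C\<^sup>2)" by (rule truncated_range_moment_le[OF assms(2,3)])
  \<comment> \<open>The bound itself rules out an infinite second moment.\<close>
  obtain k where k: "?K = ennreal k" "k \<ge> 0"
  proof (cases ?K)
    case top
    then have "ennreal (C\<^sup>2) = \<infinity>" using le assms(3) by (simp add: ennreal_mult_top top_unique)
    then show ?thesis by simp
  qed
  have "?Y2 \<in> borel_measurable M" using borel_measurable_truncated_range[of x] by measurable
  then have eq: "(\<integral>\<omega>. ?Y2 \<omega> \<partial>M) = k"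
    using k by (simp add: integral_eq_nn_integral)
  have "k > 0" using truncated_range_moment_nonzero[of x] k by (cases "k = 0") auto
  moreover have "x\<^sup>2 * k \<le> C\<^sup>2" using le k by (simp add: ennreal_mult[symmetric] ennreal_le_iff)
  ultimately show ?thesis using assms(3) eq by simp
qed

end
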